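(* Let $f\in\mathbb{R}[x,y]$ be a generic polynomial of degree $n\ge 2$, with homogeneous decomposition $f=\sum_{i=0}^n f_i$, such that every umbilic point on its graph is isolated. Suppose that $f_n$ has $L$ real linear factors, and that the polynomials $|\operatorname{Hess} f_n|$ and $\nabla f_{n-1}\cdot(\nabla f_n)^{\perp}$ have no common real linear factors. Then $$\sum_{p\ \text{umbilic}}\operatorname{Ind}(p)=1-\tfrac12 L,$$ where the sum runs over all umbilic points $p$ of the graph of $f$ and $\operatorname{Ind}(p)$ is the Poincaré–Hopf index at $p$ of either of the fields of principal directions of the graph.
   Context: Notation. $f_i$ is the homogeneous part of $f$ of degree $i$; $(a,b)^{\perp}=(b,-a)$; $|\operatorname{Hess} g|=g_{xx}g_{yy}-g_{xy}^2$. An umbilic point of the graph of $f$ in $\mathbb{R}^3$ is a point where the two principal curvatures coincide; away from umbilics the principal directions form two orthogonal line fields, whose index at an isolated umbilic is a half-integer. The form $\Phi$. Let $F(u,v,\omega)=\sum_{i=0}^n\omega^{n-i}f_i(u,v)$ and $A=F_{uv}F_u^2-F_{uu}F_uF_v+\omega^{2(n-1)}F_{uv}$, $B=F_{vv}F_u^2-F_{uu}F_v^2+\omega^{2(n-1)}(F_{vv}-F_{uu})$, $C=F_{vv}F_uF_v-F_{uv}F_v^2-\omega^{2(n-1)}F_{uv}$. The polynomial $u^2A+uvB+v^2C$ is divisible by $\omega$; let $T\in\mathbb{R}[u,v,\omega]$ be defined by $u^2A+uvB+v^2C=\omega T$. On $\mathbb{S}^2=\{u^2+v^2+\omega^2=1\}$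 consider the analytic quadratic differential form $$\Phi=\omega A\,du^2+\omega B\,du\,dv+\omega C\,dv^2-(2uA+vB)\,du\,d\omega-(uB+2vC)\,dv\,d\omega+T\,d\omega^2 .$$ It extends to $\mathbb{S}^2$ (via central projection, up to a power of $\omega$) the quadratic form on $\mathbb{R}^2$ defining the principal directions of the graph of $f$. A flat point of $\Phi$ is a point of $\mathbb{S}^2$ at which all coefficients of $\Phi$ vanish. An umbilic point at infinity is a point of the equator $\mathbb{S}^2\cap\{\omega=0\}$ that is an isolated flat point of $\Phi$. $\mathbb{Y}_1,\mathbb{Y}_2$ denote the two direction fields on $\mathbb{S}^2$ given by the zero directions of $\Phi|_{T_q\mathbb{S}^2}$; their singular points are the points $q$ where $\Phi|_{T_q\mathbb{S}^2}$ vanishes identically (equivalently, the flat points of $\Phi$). The polynomial $f$ is called generic if all the singular points of $\mathbb{Y}_1,\mathbb{Y}_2$ that lie on the equator are umbilic points at infinity. *)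

theory Defs
  imports "HOL-Analysis.Analysis" "HOL-Computational_Algebra.Polynomial"
begin

section \<open>Bivariate real polynomials\<close>

text \<open>
  The ring of polynomials in \<open>x\<close>, \<open>y\<close> is rendered as \<^typ>\<open>real poly poly\<close>, with \<open>x\<close> the
  inner and \<open>y\<close> the outer variable: the coefficient of \<open>x ^ i * y ^ j\<close> in \<open>f\<close> is
  \<open>coeff (coeff f j) i\<close>.
\<close>

type_synonym bipoly = "real poly poly"

definition eval2 :: "bipoly \<Rightarrow> real \<times> real \<Rightarrow> real" where
  "eval2 f = (\<lambda>(x, y). poly (poly f [:y:]) x)"

definition dx :: "bipoly \<Rightarrow> bipoly" where
  "dx f = map_poly pderiv f"

definition dy :: "bipoly \<Rightarrow> bipoly" where
  "dy f = pderiv f"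

definition total_degree :: "bipoly \<Rightarrow> nat" where
  "total_degree f = (LEAST d. \<forall>i j. d < i + j \<longrightarrow> coeff (coeff f j) i = 0)"

definition hom_part :: "nat \<Rightarrow> bipoly \<Rightarrow> bipoly" where
  "hom_part d f = (\<Sum>j\<le>d. monom (monom (coeff (coeff f j) (d - j)) (d - j)) j)"

definition hess :: "bipoly \<Rightarrow> bipoly" where
  "hess g = dx (dx g) * dy (dy g) - (dx (dy g))\<^sup>2"

text \<open>The scalar product of \<open>\<nabla>g\<close> with \<open>(\<nabla>h)\<^sup>\<bottom>\<close>, where \<open>(a, b)\<^sup>\<bottom> = (b, -a)\<close>.\<close>

definition grad_dot_perp_grad :: "bipoly \<Rightarrow> bipoly \<Rightarrow> bipoly" where
  "grad_dot_perp_grad g h = dx g * dy h + dy g * (- dx h)"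

definition linear_factor :: "bipoly \<Rightarrow> bipoly \<Rightarrow> bool" where
  "linear_factor l g \<longleftrightarrow> total_degree l = 1 \<and> l dvd g"

text \<open>
  Linear factors are counted with multiplicity. For the top homogeneous part in the main statement
  this agrees with counting distinct factors up to scalars: a multiple linear factor of a form
  \<open>g\<close> divides \<open>hess g\<close> and both partial derivatives of \<open>g\<close>.
\<close>

definition has_num_linear_factors :: "bipoly \<Rightarrow> nat \<Rightarrow> bool" where
  "has_num_linear_factors g L \<longleftrightarrow>
     (\<exists>ls h. length ls = L \<and> (\<forall>l \<in> set ls. total_degree l = 1) \<and>
        g = prod_list ls * h \<and> \<not> (\<exists>l. linear_factor l h))"


section \<open>The quadratic differential form on the sphere\<close>

text \<open>
  Polynomials in \<open>u\<close>, \<open>v\<close>, \<open>\<omega>\<close>, with \<open>u\<close> the innermost and \<open>\<omega>\<close> the outermost variable.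
\<close>

type_synonym tripoly = "real poly poly poly"

definition eval3 :: "tripoly \<Rightarrow> real \<times> real \<times> real \<Rightarrow> real" where
  "eval3 P = (\<lambda>(u, v, w). poly (poly (poly P [:[:w:]:]) [:v:]) u)"

definition varU :: tripoly where "varU = [:[:[:0, 1:]:]:]"
definition varV :: tripoly where "varV = [:[:0, 1:]:]"
definition varW :: tripoly where "varW = [:0, 1:]"

definition du :: "tripoly \<Rightarrow> tripoly" where
  "du P = map_poly (map_poly pderiv) P"

definition dv :: "tripoly \<Rightarrow> tripoly" where
  "dv P = map_poly pderiv P"

definition homogenization :: "bipoly \<Rightarrow> tripoly" where
  "homogenization f = (let n = total_degree f in \<Sum>i\<le>n. monom (hom_part i f) (n - i))"

definition polyA :: "bipoly \<Rightarrow> tripoly" where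
  "polyA f = (let n = total_degree f; F = homogenization f in
     du (dv F) * (du F)\<^sup>2 - du (du F) * du F * dv F + varW ^ (2 * (n - 1)) * du (dv F))"

definition polyB :: "bipoly \<Rightarrow> tripoly" where
  "polyB f = (let n = total_degree f; F = homogenization f in
     dv (dv F) * (du F)\<^sup>2 - du (du F) * (dv F)\<^sup>2
       + varW ^ (2 * (n - 1)) * (dv (dv F) - du (du F)))"

definition polyC :: "bipoly \<Rightarrow> tripoly" where
  "polyC f = (let n = total_degree f; F = homogenization f in
     dv (dv F) * du F * dv F - du (dv F) * (dv F)\<^sup>2 - varW ^ (2 * (n - 1)) * du (dv F))"

definition polyT :: "bipoly \<Rightarrow> tripoly" where
  "polyT f = (THE T. varU\<^sup>2 * polyA f + varU * varV * polyB f + varV\<^sup>2 * polyC f = varW * T)"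

text \<open>
  The coefficients of \<open>du\<^sup>2\<close>, \<open>du dv\<close>, \<open>dv\<^sup>2\<close>, \<open>du d\<omega>\<close>, \<open>dv d\<omega>\<close>, \<open>d\<omega>\<^sup>2\<close>, in this order.
\<close>

definition Phi_coeffs ::
    "bipoly \<Rightarrow> real \<times> real \<times> real \<Rightarrow> real \<times> real \<times> real \<times> real \<times> real \<times> real" where
  "Phi_coeffs f = (\<lambda>(u, v, w).
     let A = eval3 (polyA f) (u, v, w); B = eval3 (polyB f) (u, v, w);
         C = eval3 (polyC f) (u, v, w); T = eval3 (polyT f) (u, v, w)
     in (w * A, w * B, w * C, - (2 * u * A + v * B), - (u * B + 2 * v * C), T))"

definition Phi :: "bipoly \<Rightarrow> real \<times> real \<times> real \<Rightarrow> real \<times> real \<times> real \<Rightarrow> real" where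
  "Phi f q = (\<lambda>(a, b, c). let (uu, uv, vv, uw, vw, ww) = Phi_coeffs f q in
     uu * a\<^sup>2 + uv * a * b + vv * b\<^sup>2 + uw * a * c + vw * b * c + ww * c\<^sup>2)"

definition unit_sphere :: "(real \<times> real \<times> real) set" where
  "unit_sphere = sphere 0 1"

definition equator :: "(real \<times> real \<times> real) set" where
  "equator = {(u, v, w) \<in> unit_sphere. w = 0}"

definition flat_points :: "bipoly \<Rightarrow> (real \<times> real \<times> real) set" where
  "flat_points f = {q \<in> unit_sphere. Phi_coeffs f q = (0, 0, 0, 0, 0, 0)}"

definition umbilics_at_infinity :: "bipoly \<Rightarrow> (real \<times> real \<times> real) set" where
  "umbilics_at_infinity f = {q \<in> equator. q isolated_in flat_points f}"

definition singular_points :: "bipoly \<Rightarrow> (real \<times> real \<times> real) set" where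
  "singular_points f = {q \<in> unit_sphere. \<forall>t. q \<bullet> t = 0 \<longrightarrow> Phi f q t = 0}"

definition generic :: "bipoly \<Rightarrow> bool" where
  "generic f \<longleftrightarrow> singular_points f \<inter> equator \<subseteq> umbilics_at_infinity f"


section \<open>Principal curvatures and directions of the graph\<close>

text \<open>
  Points of the graph are given by their projections \<open>p\<close> to the plane, and tangent vectors by
  their coordinates \<open>s\<close> with respect to the global parametrization \<open>(x, y) \<mapsto> (x, y, f (x, y))\<close>,
  whose differential at \<open>p\<close> is \<open>graph_tangent f p\<close>.
\<close>

definition graph_tangent :: "bipoly \<Rightarrow> real \<times> real \<Rightarrow> real \<times> real \<Rightarrow> real \<times> real \<times> real" where
  "graph_tangent f p = (\<lambda>(a, b). (a, b, eval2 (dx f) p * a + eval2 (dy f) p * b))"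

definition unit_normal :: "bipoly \<Rightarrow> real \<times> real \<Rightarrow> real \<times> real \<times> real" where
  "unit_normal f p = sgn (- eval2 (dx f) p, - eval2 (dy f) p, 1)"

definition first_form :: "bipoly \<Rightarrow> real \<times> real \<Rightarrow> real \<times> real \<Rightarrow> real \<times> real \<Rightarrow> real" where
  "first_form f p s t = graph_tangent f p s \<bullet> graph_tangent f p t"

text \<open>
  The vector \<open>(0, 0, \<dots>)\<close> is the second derivative of the parametrization applied to the
  pair of vectors.
\<close>

definition second_form :: "bipoly \<Rightarrow> real \<times> real \<Rightarrow> real \<times> real \<Rightarrow> real \<times> real \<Rightarrow> real" where
  "second_form f p = (\<lambda>(a, b) (c, d). unit_normal f p \<bullet>
     (0, 0, eval2 (dx (dx f)) p * a * c + eval2 (dx (dy f)) p * (a * d + b * c)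
              + eval2 (dy (dy f)) p * b * d))"

text \<open>
  The equation \<open>\<forall>t. second_form f p s t = k * first_form f p s t\<close> says that \<open>s\<close> is mapped to
  \<open>k s\<close> by the shape operator \<open>S\<close>, as \<open>second_form f p s t = first_form f p (S s) t\<close>.
\<close>

definition curvature_eigenspace :: "bipoly \<Rightarrow> real \<times> real \<Rightarrow> real \<Rightarrow> (real \<times> real) set" where
  "curvature_eigenspace f p k = {s. \<forall>t. second_form f p s t = k * first_form f p s t}"

definition principal_curvatures :: "bipoly \<Rightarrow> real \<times> real \<Rightarrow> real set" where
  "principal_curvatures f p = {k. \<exists>s \<in> curvature_eigenspace f p k. s \<noteq> 0}"

definition max_curvature :: "bipoly \<Rightarrow> real \<times> real \<Rightarrow> real" where
  "max_curvature f p = Max (principal_curvatures f p)"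

definition min_curvature :: "bipoly \<Rightarrow> real \<times> real \<Rightarrow> real" where
  "min_curvature f p = Min (principal_curvatures f p)"

definition umbilics :: "bipoly \<Rightarrow> (real \<times> real) set" where
  "umbilics f = {p. max_curvature f p = min_curvature f p}"

text \<open>Away from umbilics, these are the two fields of principal directions.\<close>

definition max_direction :: "bipoly \<Rightarrow> real \<times> real \<Rightarrow> (real \<times> real) set" where
  "max_direction f p = curvature_eigenspace f p (max_curvature f p)"

definition min_direction :: "bipoly \<Rightarrow> real \<times> real \<Rightarrow> (real \<times> real) set" where
  "min_direction f p = curvature_eigenspace f p (min_curvature f p)"


section \<open>Index of a planar line field\<close>

text \<open>
  The index is the number of turns (in multiples of \<open>2\<pi>\<close>, hence a half-integer) of the line along
  a small positively oriented circle around the point. As the index is invariant under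
  diffeomorphisms, the index of a line field on the graph may be computed in the parameter plane.
\<close>

definition has_line_index ::
    "(real \<times> real \<Rightarrow> (real \<times> real) set) \<Rightarrow> real \<times> real \<Rightarrow> real \<Rightarrow> bool" where
  "has_line_index \<Lambda> p i \<longleftrightarrow>
     (\<forall>\<^sub>F r in at_right 0. \<exists>\<theta> :: real \<Rightarrow> real. continuous_on {0..1} \<theta> \<and>
        (\<forall>t \<in> {0..1}. \<Lambda> (p + r *\<^sub>R (cos (2 * pi * t), sin (2 * pi * t)))
                        = span {(cos (\<theta> t), sin (\<theta> t))}) \<and>
        \<theta> 1 - \<theta> 0 = 2 * pi * i)"

definition line_index ::
    "(real \<times> real \<Rightarrow> (real \<times> real) set) \<Rightarrow> real \<times> real \<Rightarrow> real" where
  "line_index \<Lambda> p = (THE i. has_line_index \<Lambda> p i)"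

end

theory Submission imports Defs begin

text \<open>
  The two principal directions of the graph of \<open>f\<close> are the zeros of a quadratic differential form
  \<open>a dx\<^sup>2 + b dx dy + c dy\<^sup>2\<close> with polynomial coefficients. The complex-valued function \<open>W = a - c + i b\<close> on the
  plane vanishes exactly at the umbilics, and along any path in the complement of the umbilics the square of a
  vector in either principal direction remains in an open half plane relative to \<open>W\<close>
  (\<open>eigenvector_square\<close>). The index at an umbilic is therefore half of the turning number of \<open>W\<close> along a small
  circle (\<open>principal_index\<close>). The turning numbers around the zeros of \<open>W\<close> add up to the turning number along any
  circle that encloses them (\<open>sum_of_local_turns\<close>), so everything is reduced to computing the latter for large
  circles.

  There \<open>W\<close> factors to leading order: up to terms that are linear in the second derivatives of \<open>f\<close>, \<open>- W\<close> is the
  product of the complex numbers \<open>\<nabla>f\<close> and \<open>V\<close>, where \<open>V\<close> is the covector \<open>Hess f (\<cdot>, (\<nabla>f)\<^sup>\<bottom>)\<close>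
  (\<open>direction_field_eq\<close>). Let \<open>g = f\<^sub>n\<close>, \<open>h = f\<^bsub>n-1\<^esub>\<close>, \<open>H = \<bar>Hess g\<bar>\<close> and \<open>J = \<nabla>h \<cdot> (\<nabla>g)\<^sup>\<bottom>\<close>. As \<open>H\<close> and \<open>J\<close> are forms
  without common linear factors, they have no common zero on the unit circle. In polar coordinates, \<open>J\<close> and \<open>H\<close> are up
  to constant factors the leading terms of the radial and angular components of \<open>V\<close>; moreover \<open>\<nabla>g\<close> has no zero on the
  circle, because \<open>H\<close> and \<open>J\<close> would vanish at such a point. With \<open>k = n - 2\<close> this gives
  \<open>\<bar>\<nabla>f\<bar> \<bar>V\<bar> \<ge> \<epsilon> r ^ (3 k + 1)\<close>, whereas the correction is of order \<open>r ^ k\<close>. So there are no umbilics far out, and \<open>W\<close>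
  turns as often as \<open>\<nabla>g\<close> and \<open>V\<close> together (\<open>turns_direction_field_at_infinity\<close>).

  The gradient of \<open>g\<close> turns \<open>1 - L\<close> times: once with the polar frame, and once in the opposite direction for
  each real linear factor (\<open>turns_gradient_of_form\<close>). The covector \<open>V\<close> turns once, with the polar frame: relative
  to it, the path \<open>J + i H\<close> does not turn, since \<open>J\<close> is odd and \<open>H\<close> is even
  (\<open>turns_conj_direction_at_infinity\<close>). Altogether \<open>W\<close> turns \<open>2 - L\<close> times, and half of that is the sum of the
  indices.
\<close>

section \<open>Turning numbers of periodic functions\<close>

text \<open>
  The turning number of a \<open>2\<pi>\<close>-periodic path in the punctured plane. Asking for a logarithm on the whole
  real line, instead of on one period, makes products, powers, shifts and reflections immediate.
\<close>

definition turns :: "(real \<Rightarrow> complex) \<Rightarrow> int \<Rightarrow> bool" where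
  "turns \<phi> k \<longleftrightarrow> (\<exists>q. continuous_on UNIV q \<and> (\<forall>t. \<phi> t = exp (q t)) \<and>
      (\<forall>t. q (t + 2 * pi) = q t + of_int k * (2 * of_real pi * \<i>)))"

definition nonvanishing_loop :: "(real \<Rightarrow> complex) \<Rightarrow> bool" where
  "nonvanishing_loop \<phi> \<longleftrightarrow> continuous_on UNIV \<phi> \<and> (\<forall>t. \<phi> t \<noteq> 0) \<and> (\<forall>t. \<phi> (t + 2 * pi) = \<phi> t)"

lemma integer_valued_constant:
  fixes d :: "'a::real_normed_vector \<Rightarrow> complex"
  assumes "connected S" "continuous_on S d" "\<And>x. x \<in> S \<Longrightarrow> d x \<in> \<int>" "S \<noteq> {}"
  obtains k :: int where "\<And>x. x \<in> S \<Longrightarrow> d x = of_int k"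
proof -
  have "d constant_on S"
  proof (rule continuous_discrete_range_constant[OF assms(1,2)])
    fix x assume x: "x \<in> S"
    have "1 \<le> norm (d y - d x)" if y: "y \<in> S" "d y \<noteq> d x" for y
    proof -
      obtain a where a: "d y = of_int a" by (rule Ints_cases[OF assms(3)[OF y(1)]])
      obtain b where b: "d x = of_int b" by (rule Ints_cases[OF assms(3)[OF x]])
      note ab = a b
      then have "d y - d x = of_int (a - b)" "a \<noteq> b" using y by auto
      then have "norm (d y - d x) = real_of_int \<bar>a - b\<bar>" "\<bar>a - b\<bar> \<ge> 1" 
        by (auto simp only: norm_of_int)
      then show ?thesis by linarith
    qed
    then show "\<exists>e>0. \<forall>y. y \<in> S \<and> d y \<noteq> d x \<longrightarrow> e \<le> norm (d y - d x)"
      by (intro exI[of _ 1]) auto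
  qed
  then obtain c where c: "\<And>x. x \<in> S \<Longrightarrow> d x = c" by (auto simp: constant_on_def)
  obtain x where x: "x \<in> S" using assms(4) by blast
  obtain k where "d x = of_int k" by (rule Ints_cases[OF assms(3)[OF x]])
  then show ?thesis using that[of k] c x by simp
qed

lemma exp_eq_imp_Ints:
  assumes "exp a = exp b"
  shows "(a - b) / (2 * of_real pi * \<i>) \<in> \<int>"
proof -
  obtain n :: int where "a = b + (of_int (2 * n) * pi) * \<i>"
    using assms by (auto simp: exp_eq)
  then have "(a - b) / (2 * of_real pi * \<i>) = of_int n"
    by (simp add: field_simps)
  then show ?thesis by simp
qed

text \<open>
  Homotopy invariance. A logarithm exists on the contractible strip \<open>S \<times> \<real>\<close>, and its increment over
  one period is a continuous function with values in a discrete set.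
\<close>

lemma turns_family:
  fixes \<Phi> :: "real \<Rightarrow> real \<Rightarrow> complex"
  assumes S: "convex S" "S \<noteq> {}"
    and cont: "continuous_on (S \<times> UNIV) (\<lambda>(s, t). \<Phi> s t)"
    and nz: "\<And>s t. s \<in> S \<Longrightarrow> \<Phi> s t \<noteq> 0"
    and per: "\<And>s t. s \<in> S \<Longrightarrow> \<Phi> s (t + 2 * pi) = \<Phi> s t"
  obtains k where "\<And>s. s \<in> S \<Longrightarrow> turns (\<Phi> s) k"
proof -
  let ?D = "S \<times> (UNIV :: real set)"
  have conv: "convex ?D" by (intro convex_Times S) auto
  obtain q where q: "continuous_on ?D q" "\<And>x. x \<in> ?D \<Longrightarrow> (\<lambda>(s, t). \<Phi> s t) x = exp (q x)"
    by (rule continuous_logarithm_on_contractible[OF cont convex_imp_contractible[OF conv]])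
      (use nz in auto)
  define d where "d = (\<lambda>x. (q (fst x, snd x + 2 * pi) - q x) / (2 * of_real pi * \<i>))"
  have "continuous_on ?D d"
    unfolding d_def
    by (intro continuous_intros q(1) continuous_on_compose2[OF q(1)]) auto
  moreover have "d x \<in> \<int>" if "x \<in> ?D" for x
    unfolding d_def
  proof (rule exp_eq_imp_Ints)
    show "exp (q (fst x, snd x + 2 * pi)) = exp (q x)"
      using q(2)[of x] q(2)[of "(fst x, snd x + 2 * pi)"] per[of "fst x" "snd x"] that
      by (auto simp: split_beta)
  qed
  ultimately obtain k where k: "\<And>x. x \<in> ?D \<Longrightarrow> d x = of_int k"
    using integer_valued_constant[OF convex_connected[OF conv]] S(2) by blast
  have "turns (\<Phi> s) k" if "s \<in> S" for s
    unfolding turns_def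
  proof (intro exI conjI allI)
    show "continuous_on UNIV (\<lambda>t. q (s, t))"
      by (intro continuous_on_compose2[OF q(1)] continuous_intros) (use that in auto)
    show "\<Phi> s t = exp (q (s, t))" for t using q(2)[of "(s, t)"] that by simp
    show "q (s, t + 2 * pi) = q (s, t) + of_int k * (2 * of_real pi * \<i>)" for t
      using k[of "(s, t)"] that by (simp add: d_def field_simps)
  qed
  then show ?thesis using that by blast
qed

lemma turns_exists:
  assumes "nonvanishing_loop \<phi>"
  obtains k where "turns \<phi> k"
proof -
  have "continuous_on ({0::real} \<times> UNIV) (\<lambda>(s, t). \<phi> t)"
    using assms unfolding nonvanishing_loop_def split_beta
    by (intro continuous_on_compose2[of UNIV \<phi> _ snd] continuous_intros) auto
  then obtain k where "\<And>s. s \<in> {0::real} \<Longrightarrow> turns \<phi> k"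
    using assms unfolding nonvanishing_loop_def
    by (elim turns_family[of "{0}" "\<lambda>s t. \<phi> t", rotated 2]) simp_all
  then show ?thesis using that by blast
qed

lemma turns_imp_loop: "turns \<phi> k \<Longrightarrow> nonvanishing_loop \<phi>"
proof -
  assume "turns \<phi> k"
  then obtain q where q: "continuous_on UNIV q" "\<And>t. \<phi> t = exp (q t)"
      "\<And>t. q (t + 2 * pi) = q t + of_int k * (2 * of_real pi * \<i>)"
    unfolding turns_def by blast
  have "\<phi> = (\<lambda>t. exp (q t))" using q(2) by auto
  moreover have "exp (of_int k * (2 * of_real pi * \<i>)) = 1"
    by (subst exp_eq_1) auto
  ultimately show ?thesis unfolding nonvanishing_loop_def
    by (auto intro!: continuous_intros q(1) simp: q(3) exp_add)
qed

lemma turns_unique: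
  assumes "turns \<phi> k" "turns \<phi> l"
  shows "k = l"
proof -
  obtain q where q: "continuous_on UNIV q" "\<And>t. \<phi> t = exp (q t)"
      "\<And>t. q (t + 2 * pi) = q t + of_int k * (2 * of_real pi * \<i>)"
    using assms(1) unfolding turns_def by blast
  obtain q' where q': "continuous_on UNIV q'" "\<And>t. \<phi> t = exp (q' t)"
      "\<And>t. q' (t + 2 * pi) = q' t + of_int l * (2 * of_real pi * \<i>)"
    using assms(2) unfolding turns_def by blast
  \<comment> \<open>Two logarithms of the same path differ by a constant.\<close>
  have "continuous_on UNIV (\<lambda>t. (q t - q' t) / (2 * of_real pi * \<i>))"
    by (intro continuous_intros q(1) q'(1)) auto
  moreover have "(q t - q' t) / (2 * of_real pi * \<i>) \<in> \<int>" for t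
    using exp_eq_imp_Ints[of "q t" "q' t"] q(2)[of t] q'(2)[of t] by simp
  ultimately obtain m where m: "\<And>t. (q t - q' t) / (2 * of_real pi * \<i>) = of_int m"
    using integer_valued_constant[of "UNIV :: real set" "\<lambda>t. (q t - q' t) / (2 * of_real pi * \<i>)"]
    by auto
  have "q t - q' t = of_int m * (2 * of_real pi * \<i>)" for t
    using m[of t] by (simp add: field_simps)
  from this[of 0] this[of "0 + 2 * pi"] have "(of_int k - of_int l) * (2 * of_real pi * \<i>) = 0"
    unfolding q(3) q'(3) by (simp add: algebra_simps)
  then show ?thesis by simp
qed

lemma turns_mult:
  assumes "turns \<phi> k" "turns \<psi> l"
  shows "turns (\<lambda>t. \<phi> t * \<psi> t) (k + l)"
proof -
  obtain q where q: "continuous_on UNIV q" "\<And>t. \<phi> t = exp (q t)"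
      "\<And>t. q (t + 2 * pi) = q t + of_int k * (2 * of_real pi * \<i>)"
    using assms(1) unfolding turns_def by blast
  obtain q' where q': "continuous_on UNIV q'" "\<And>t. \<psi> t = exp (q' t)"
      "\<And>t. q' (t + 2 * pi) = q' t + of_int l * (2 * of_real pi * \<i>)"
    using assms(2) unfolding turns_def by blast
  show ?thesis unfolding turns_def
    by (rule exI[of _ "\<lambda>t. q t + q' t"])
      (auto intro!: continuous_intros q(1) q'(1) simp: q(2,3) q'(2,3) exp_add distrib_right)
qed

lemma turns_power_int:
  assumes "turns \<phi> k"
  shows "turns (\<lambda>t. \<phi> t powi m) (m * k)"
proof -
  obtain q where q: "continuous_on UNIV q" "\<And>t. \<phi> t = exp (q t)"
      "\<And>t. q (t + 2 * pi) = q t + of_int k * (2 * of_real pi * \<i>)"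
    using assms(1) unfolding turns_def by blast
  show ?thesis unfolding turns_def
    by (rule exI[of _ "\<lambda>t. of_int m * q t"])
      (auto intro!: continuous_intros q(1) simp: q(2,3) exp_power_int distrib_left)
qed

lemma turns_cnj:
  assumes "turns \<phi> k"
  shows "turns (\<lambda>t. cnj (\<phi> t)) (- k)"
proof -
  obtain q where q: "continuous_on UNIV q" "\<And>t. \<phi> t = exp (q t)"
      "\<And>t. q (t + 2 * pi) = q t + of_int k * (2 * of_real pi * \<i>)"
    using assms(1) unfolding turns_def by blast
  show ?thesis unfolding turns_def
    by (rule exI[of _ "\<lambda>t. cnj (q t)"])
      (auto intro!: continuous_intros q(1) simp: q(2,3) exp_cnj)
qed

lemma turns_shift:
  assumes "turns \<phi> k"
  shows "turns (\<lambda>t. \<phi> (t + a)) k"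
proof -
  obtain q where q: "continuous_on UNIV q" "\<And>t. \<phi> t = exp (q t)"
      "\<And>t. q (t + 2 * pi) = q t + of_int k * (2 * of_real pi * \<i>)"
    using assms(1) unfolding turns_def by blast
  show ?thesis unfolding turns_def
  proof (intro exI conjI allI)
    show "continuous_on UNIV (\<lambda>t. q (t + a))"
      by (intro continuous_on_compose2[OF q(1)] continuous_intros) auto
    show "q (t + 2 * pi + a) = q (t + a) + of_int k * (2 * of_real pi * \<i>)" for t
      using q(3)[of "t + a"] by (simp add: algebra_simps)
  qed (simp add: q(2))
qed

lemma turns_cis: "turns cis 1"
  unfolding turns_def
  by (rule exI[of _ "\<lambda>t. \<i> * of_real t"]) (auto intro!: continuous_intros simp: cis_conv_exp algebra_simps)

lemma turns_const: "c \<noteq> 0 \<Longrightarrow> turns (\<lambda>t. c) 0"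
  unfolding turns_def by (rule exI[of _ "\<lambda>t. Ln c"]) auto

lemma turns_half_plane:
  assumes "nonvanishing_loop \<phi>" "\<And>t. Re (c * \<phi> t) > 0"
  shows "turns \<phi> 0"
proof -
  have c: "c \<noteq> 0" using assms(2)[of 0] by auto
  have per: "\<phi> (t + 2 * pi) = \<phi> t" for t using assms(1) by (simp add: nonvanishing_loop_def)
  have cont: "continuous_on UNIV \<phi>" using assms(1) by (simp add: nonvanishing_loop_def)
  have nz: "c * \<phi> t \<noteq> 0" for t using assms(2)[of t] by auto
  have "turns (\<lambda>t. c * \<phi> t) 0" unfolding turns_def
  proof (intro exI conjI allI)
    show "continuous_on UNIV (\<lambda>t. Ln (c * \<phi> t))"
      using assms(2) by (intro continuous_intros cont) (metis complex_nonpos_Reals_iff not_less)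
    show "c * \<phi> t = exp (Ln (c * \<phi> t))" for t using exp_Ln[OF nz] by simp
  qed (simp add: per)
  from turns_mult[OF turns_const[of "inverse c"] this] c show ?thesis
    by (simp add: field_simps)
qed

text \<open>
  The main tool for comparing turning numbers: the hypothesis confines the quotient \<open>\<psi> / \<phi>\<close> to an open
  half plane, where the principal branch of the logarithm is periodic.
\<close>

lemma turns_transfer:
  assumes "turns \<phi> k" "nonvanishing_loop \<psi>" "\<And>t. Re (c * cnj (\<phi> t) * \<psi> t) > 0"
  shows "turns \<psi> k"
proof -
  have phi: "nonvanishing_loop \<phi>" by (rule turns_imp_loop[OF assms(1)])
  have "nonvanishing_loop (\<lambda>t. \<psi> t / \<phi> t)"
    using phi assms(2) unfolding nonvanishing_loop_def by (auto intro!: continuous_intros)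
  moreover have "Re (c * (\<psi> t / \<phi> t)) > 0" for t
  proof -
    have nz: "\<phi> t \<noteq> 0" using phi by (simp add: nonvanishing_loop_def)
    have "c * (\<psi> t / \<phi> t) = (c * cnj (\<phi> t) * \<psi> t) / of_real ((cmod (\<phi> t))\<^sup>2)"
      unfolding complex_norm_square using nz by (simp add: field_simps)
    then show ?thesis using assms(3)[of t] nz by (simp add: Re_divide_of_real)
  qed
  ultimately have "turns (\<lambda>t. \<psi> t / \<phi> t) 0" by (rule turns_half_plane)
  from turns_mult[OF assms(1) this] phi show ?thesis
    by (simp add: nonvanishing_loop_def)
qed

lemma turns_Rouche:
  assumes "turns \<phi> k" "continuous_on UNIV \<psi>" "\<And>t. \<psi> (t + 2 * pi) = \<psi> t"
    "\<And>t. cmod (\<psi> t - \<phi> t) < cmod (\<phi> t)"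
  shows "turns \<psi> k"
proof (rule turns_transfer[OF assms(1), where c = 1])
  show "nonvanishing_loop \<psi>"
    using assms(2,3) assms(4) unfolding nonvanishing_loop_def
    by (metis diff_0 less_irrefl norm_minus_cancel)
  fix t
  have "cmod (cnj (\<phi> t) * (\<psi> t - \<phi> t)) < (cmod (\<phi> t))\<^sup>2"
    using assms(4)[of t] by (auto simp: norm_mult power2_eq_square intro!: mult_strict_left_mono
       intro: le_less_trans[OF norm_ge_zero])
  moreover have "Re (cnj (\<phi> t) * \<psi> t) = (cmod (\<phi> t))\<^sup>2 + Re (cnj (\<phi> t) * (\<psi> t - \<phi> t))"
    unfolding cmod_power2 by (simp add: algebra_simps power2_eq_square)
  moreover have "\<bar>Re (cnj (\<phi> t) * (\<psi> t - \<phi> t))\<bar> \<le> cmod (cnj (\<phi> t) * (\<psi> t - \<phi> t))"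
    by (rule abs_Re_le_cmod)
  ultimately show "0 < Re (1 * cnj (\<phi> t) * \<psi> t)" by simp
qed

text \<open>
  The second half of the path is the mirror image of the first one, so it undoes the turning of the
  first half: \<open>-cnj \<phi>\<close> turns opposite to \<open>\<phi>\<close>, but here it is a shift of \<open>\<phi>\<close>.
\<close>

lemma turns_reflected_half_turn:
  assumes "nonvanishing_loop \<phi>" "\<And>t. \<phi> (t + pi) = - cnj (\<phi> t)"
  shows "turns \<phi> 0"
proof -
  obtain k where k: "turns \<phi> k" using turns_exists[OF assms(1)] .
  have "turns (\<lambda>t. (-1) * cnj (\<phi> t)) (0 + - k)"
    by (intro turns_mult turns_const turns_cnj k) simp
  then have "turns (\<lambda>t. \<phi> (t + pi)) (- k)" by (simp add: assms(2))
  from turns_unique[OF this turns_shift[OF k]] k show ?thesis by simp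
qed

section \<open>Turning along circles in the plane\<close>

definition circle :: "complex \<Rightarrow> real \<Rightarrow> real \<Rightarrow> complex" where
  "circle p r t = p + of_real r * cis t"

lemma circle_periodic [simp]: "circle p r (t + 2 * pi) = circle p r t"
  by (simp add: circle_def cis.code complex_eq_iff)

lemma continuous_circle [continuous_intros]:
  "continuous_on S g \<Longrightarrow> continuous_on S h \<Longrightarrow> continuous_on S (\<lambda>x. circle p (g x) (h x))"
  unfolding circle_def by (intro continuous_intros)

lemma dist_circle [simp]: "dist p (circle p r t) = \<bar>r\<bar>" 
  by (simp add: circle_def dist_norm norm_mult)

lemma norm_circle0 [simp]: "cmod (circle 0 r t) = \<bar>r\<bar>"
  by (simp add: circle_def norm_mult)

text \<open>
  The radius is the homotopy parameter.
\<close>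

lemma turns_circles:
  assumes I: "convex I" "I \<noteq> {}"
    and F: "continuous_on T F" "\<And>z. z \<in> T \<Longrightarrow> F z \<noteq> 0"
    and sub: "\<And>r t. r \<in> I \<Longrightarrow> circle p r t \<in> T"
  obtains k where "\<And>r. r \<in> I \<Longrightarrow> turns (\<lambda>t. F (circle p r t)) k"
proof (rule turns_family[OF I, of "\<lambda>r t. F (circle p r t)"])
  show "continuous_on (I \<times> UNIV) (\<lambda>(r, t). F (circle p r t))"
    unfolding split_beta
    by (intro continuous_on_compose2[OF F(1)] continuous_intros) (auto simp: sub)
qed (use F(2) sub that in auto)

text \<open>
  Shrink the circle to its centre, where the path becomes constant.
\<close>

lemma turns_circle_disc:
  assumes "continuous_on (cball p r) F" "\<And>z. z \<in> cball p r \<Longrightarrow> F z \<noteq> 0" "r \<ge> 0"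
  shows "turns (\<lambda>t. F (circle p r t)) 0"
proof -
  obtain k where k: "\<And>s. s \<in> {0..r} \<Longrightarrow> turns (\<lambda>t. F (circle p s t)) k"
    by (rule turns_circles[of "{0..r}" "cball p r" F]) (use assms in auto)
  have "turns (\<lambda>t. F (circle p 0 t)) 0" 
    unfolding circle_def using turns_const[of "F p"] assms by simp
  then have "k = 0" using turns_unique k[of 0] assms(3) by auto
  then show ?thesis using k[of r] assms(3) by simp
qed

lemma turns_circle_linear:
  assumes "cmod (p - c) < r"
  shows "turns (\<lambda>t. circle c r t - p) 1"
proof (rule turns_Rouche[where \<phi> = "\<lambda>t. of_real r * cis t"])
  have "0 < r" using assms norm_ge_zero le_less_trans by blast
  then show "turns (\<lambda>t. of_real r * cis t) 1"
    using turns_mult[OF turns_const[of "of_real r"] turns_cis] by simp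
  show "continuous_on UNIV (\<lambda>t. circle c r t - p)" by (intro continuous_intros)
  show "cmod (circle c r t - p - of_real r * cis t) < cmod (of_real r * cis t)" for t
    using assms \<open>0 < r\<close> by (simp add: circle_def norm_mult norm_minus_commute)
qed simp

lemma periodic_int:
  fixes q :: "real \<Rightarrow> 'a"
  assumes "\<And>t. q (t + 2 * pi) = q t"
  shows "q (t + 2 * pi * of_int n) = q t"
proof (induction n rule: int_induct[of _ 0])
  case (step1 i)
  then show ?case using assms[of "t + 2 * pi * of_int i"] by (simp add: algebra_simps)
next
  case (step2 i)
  then show ?case using assms[of "t + 2 * pi * of_int (i - 1)"] by (simp add: algebra_simps)
qed simp

text \<open>
  The logarithm along the parametrized circle descends to the circle because it is periodic. As
  \<open>Arg\<close> jumps on the negative axis, continuity there is read off from \<open>Arg2pi\<close>.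
\<close>

lemma log_on_sphere:
  assumes "turns (\<lambda>t. F (circle p r t)) 0" "r > 0"
  obtains g where "continuous_on (sphere p r) g" "\<And>z. z \<in> sphere p r \<Longrightarrow> F z = exp (g z)"
proof -
  obtain q where q: "continuous_on UNIV q" "\<And>t. F (circle p r t) = exp (q t)"
      "\<And>t. q (t + 2 * pi) = q t"
    using assms(1) unfolding turns_def by auto
  define g where "g = (\<lambda>z. q (Arg (z - p)))"
  have Arg2pi: "q (Arg z) = q (Arg2pi z)" if "z \<noteq> 0" for z
  proof -
    have "exp (\<i> * of_real (Arg z)) = exp (\<i> * of_real (Arg2pi z))"
      using Arg_eq[OF that] Arg2pi_eq[of z] that by (metis mult_left_cancel norm_eq_zero of_real_eq_0_iff)
    then obtain n where "\<i> * of_real (Arg z) = \<i> * of_real (Arg2pi z) + (of_int (2 * n) * pi) * \<i>"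
      unfolding exp_eq by blast
    then have "Arg z = Arg2pi z + 2 * pi * of_int n"
      by (simp add: complex_eq_iff algebra_simps)
    then show ?thesis using periodic_int[of q, OF q(3)] by simp
  qed
  have qc: "isCont q t" for t using q(1) by (simp add: continuous_on_eq_continuous_at)
  have "isCont (\<lambda>z. q (Arg z)) z" if z: "z \<noteq> 0" for z
  proof (cases "z \<in> \<real>\<^sub>\<le>\<^sub>0")
    case False
    then show ?thesis using continuous_at_Arg qc isCont_o2 by blast
  next
    case True
    then have "z \<notin> \<real>\<^sub>\<ge>\<^sub>0" using z by (auto simp: complex_nonpos_Reals_iff complex_nonneg_Reals_iff complex_eq_iff)
    then have "isCont (\<lambda>z. q (Arg2pi z)) z" using continuous_at_Arg2pi qc isCont_o2 by blast
    moreover have "\<forall>\<^sub>F w in nhds z. q (Arg w) = q (Arg2pi w)"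
      using t1_space_nhds[OF z] by eventually_elim (auto simp: Arg2pi)
    ultimately show ?thesis using isCont_cong[of "\<lambda>z. q (Arg z)" "\<lambda>z. q (Arg2pi z)" z] by simp
  qed
  then have "isCont g z" if "z \<noteq> p" for z
    unfolding g_def using that
    by (intro isCont_o2[where g = "\<lambda>z. q (Arg z)" and f = "\<lambda>z. z - p"] continuous_intros) auto
  then have "continuous_on (sphere p r) g"
    using \<open>r > 0\<close> by (intro continuous_at_imp_continuous_on) auto
  moreover have "F z = exp (g z)" if "z \<in> sphere p r" for z
  proof -
    have "z - p = of_real (cmod (z - p)) * exp (\<i> * of_real (Arg (z - p)))"
      using that \<open>r > 0\<close> by (intro Arg_eq) auto
    then have "z = circle p r (Arg (z - p))"
      using that by (simp add: circle_def cis_conv_exp dist_norm norm_minus_commute algebra_simps)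
    then show ?thesis using q(2)[of "Arg (z - p)"] by (simp add: g_def)
  qed
  ultimately show ?thesis using that by blast
qed

text \<open>
  A puncture around which the function does not turn is removable: extend the logarithm from the small
  circle to the disc by Tietze's theorem and exponentiate.
\<close>

lemma fill_in_disc:
  assumes F: "continuous_on (T - {p}) F" "\<And>z. z \<in> T - {p} \<Longrightarrow> F z \<noteq> 0"
    and T: "cball p r \<subseteq> T" "r > 0" and turn: "turns (\<lambda>t. F (circle p r t)) 0"
  obtains G where "continuous_on T G" "\<And>z. z \<in> T \<Longrightarrow> G z \<noteq> 0" "\<And>z. r \<le> dist p z \<Longrightarrow> G z = F z"
proof -
  obtain g where g: "continuous_on (sphere p r) g" "\<And>z. z \<in> sphere p r \<Longrightarrow> F z = exp (g z)"
    using log_on_sphere[OF turn T(2)] by blast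
  obtain h where h: "continuous_on UNIV h" "\<And>z. z \<in> sphere p r \<Longrightarrow> h z = g z"
    by (rule Tietze_unbounded[OF g(1), of UNIV]) auto
  define G where "G = (\<lambda>z. if z \<in> cball p r then exp (h z) else F z)"
  have eq: "exp (h z) = F z" if "dist p z = r" for z
    using that g(2) h(2) by (simp add: sphere_def)
  show ?thesis
  proof
    have "continuous_on (cball p r \<union> (T - ball p r)) G"
      unfolding G_def
    proof (rule continuous_on_cases_local)
      show "closedin (top_of_set (cball p r \<union> (T - ball p r))) (cball p r)"
        by (simp add: closed_subset)
      have "cball p r \<union> (T - ball p r) = T" using T(1) by auto
      then show "closedin (top_of_set (cball p r \<union> (T - ball p r))) (T - ball p r)"
        by (simp add: closedin_closed) (metis Diff_eq closed_Compl open_ball)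
      show "continuous_on (cball p r) (\<lambda>z. exp (h z))"
        by (intro continuous_intros continuous_on_subset[OF h(1)]) auto
      show "continuous_on (T - ball p r) F"
        by (rule continuous_on_subset[OF F(1)]) (use T(2) in auto)
    qed (auto intro!: eq)
    moreover have "cball p r \<union> (T - ball p r) = T" using T(1) by auto
    ultimately show "continuous_on T G" by simp
    show "G z \<noteq> 0" if "z \<in> T" for z using that F(2)[of z] T(2) by (cases "z = p") (auto simp: G_def)
    show "G z = F z" if "r \<le> dist p z" for z using that eq by (auto simp: G_def)
  qed
qed

text \<open>
  The topological content of the Poincare-Hopf formula in the plane. One zero \<open>p\<close> at a time is removed:
  dividing by \<open>(z - p) powi k p\<close> makes the turning number around \<open>p\<close> vanish, so that \<open>p\<close> can be filled in,
  and changes the turning number on the large circle by exactly \<open>k p\<close>.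
\<close>

lemma sum_of_local_turns:
  assumes "finite Z" "continuous_on (- Z) F" "\<And>z. z \<notin> Z \<Longrightarrow> F z \<noteq> 0"
    and "\<And>p. p \<in> Z \<Longrightarrow> \<forall>\<^sub>F r in at_right 0. turns (\<lambda>t. F (circle p r t)) (k p)"
    and "Z \<subseteq> ball 0 R" "R > 0"
  shows "turns (\<lambda>t. F (circle 0 R t)) (\<Sum>p\<in>Z. k p)"
  using assms(1-5)
proof (induction Z arbitrary: F rule: finite_induct)
  case empty
  then show ?case using turns_circle_disc[of 0 R F] \<open>R > 0\<close> by (auto intro: continuous_on_subset)
next
  case (insert p Z)
  define P where "P = (\<lambda>z. (z - p) powi k p)"
  define F1 where "F1 = (\<lambda>z. F z * (z - p) powi (- k p))"
  have F1P: "F z = F1 z * P z" if "z \<noteq> p" for z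
    using that by (simp add: F1_def P_def power_int_minus)
  have contF1: "continuous_on (- insert p Z) F1"
    unfolding F1_def by (intro continuous_intros insert) auto
  have nzF1: "F1 z \<noteq> 0" if "z \<notin> insert p Z" for z
    using that insert.prems(2)[of z] by (auto simp: F1_def power_int_eq_0_iff)
  have "open (ball 0 R - Z)" using insert.hyps by (intro open_Diff finite_imp_closed) auto
  moreover have "p \<in> ball 0 R - Z" using insert by auto
  ultimately obtain \<delta> where \<delta>: "\<delta> > 0" "cball p \<delta> \<subseteq> ball 0 R - Z"
    using open_contains_cball by blast
  have turnF1: "turns (\<lambda>t. F1 (circle p r t)) 0"
    if "turns (\<lambda>t. F (circle p r t)) (k p)" "r > 0" for r
  proof -
    have "turns (\<lambda>t. circle p r t - p) 1" using \<open>r > 0\<close> by (intro turns_circle_linear) auto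
    from turns_mult[OF that(1) turns_power_int[OF this, of "- k p"]]
    show ?thesis by (simp add: F1_def)
  qed
  have "\<forall>\<^sub>F r in at_right 0. r > (0::real)" by (rule eventually_at_right_less)
  moreover have "\<forall>\<^sub>F r in at_right 0. r < \<delta>" using \<delta>(1) eventually_at_right_field by blast
  ultimately have "\<forall>\<^sub>F r in at_right 0. 0 < r \<and> r < \<delta> \<and> turns (\<lambda>t. F1 (circle p r t)) 0"
    using insert.prems(3)[OF insertI1]
  proof eventually_elim
    case (elim r)
    then show ?case using turnF1 by blast
  qed
  then obtain \<epsilon> where \<epsilon>: "0 < \<epsilon>" "\<epsilon> < \<delta>" "turns (\<lambda>t. F1 (circle p \<epsilon> t)) 0"
    using eventually_happens[of _ "at_right (0::real)"] by (auto simp: trivial_limit_at_right_real)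
  have sub: "cball p \<epsilon> \<subseteq> ball 0 R - Z" using \<delta> \<epsilon> by force
  obtain G where G: "continuous_on (- Z) G" "\<And>z. z \<in> - Z \<Longrightarrow> G z \<noteq> 0"
      "\<And>z. \<epsilon> \<le> dist p z \<Longrightarrow> G z = F1 z"
  proof (rule fill_in_disc[of "- Z" p F1 \<epsilon>])
    show "continuous_on (- Z - {p}) F1" by (rule continuous_on_subset[OF contF1]) auto
  qed (use nzF1 sub \<epsilon> in auto)
  have "turns (\<lambda>t. G (circle 0 R t)) (\<Sum>p\<in>Z. k p)"
  proof (rule insert.IH)
    fix p' assume p': "p' \<in> Z"
    have "open (- cball p \<epsilon>)" "p' \<in> - cball p \<epsilon>" using sub p' by auto
    then obtain \<eta> where \<eta>: "\<eta> > 0" "cball p' \<eta> \<subseteq> - cball p \<epsilon>"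
      using open_contains_cball by blast
    have "\<forall>\<^sub>F r in at_right 0. turns (\<lambda>t. F (circle p' r t)) (k p')"
      using insert.prems(3) p' by auto
    moreover have "\<forall>\<^sub>F r in at_right 0. r > (0::real)" by (rule eventually_at_right_less)
    moreover have "\<forall>\<^sub>F r in at_right 0. r < \<eta>" using \<eta>(1) eventually_at_right_field by blast
    ultimately show "\<forall>\<^sub>F r in at_right 0. turns (\<lambda>t. G (circle p' r t)) (k p')"
    proof eventually_elim
      case (elim r)
      have out: "\<epsilon> < dist p z" if "z \<in> cball p' r" for z
      proof -
        have "z \<in> cball p' \<eta>" using that elim by auto
        then show ?thesis using \<eta>(2) by auto
      qed
      have "turns (\<lambda>t. (circle p' r t - p) powi (- k p)) 0"
        using elim out \<epsilon> by (intro turns_circle_disc[where F = "\<lambda>z. (z - p) powi (- k p)"] continuous_intros)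
         (force simp: power_int_eq_0_iff)+
      from turns_mult[OF elim(1) this] 
      have "turns (\<lambda>t. F1 (circle p' r t)) (k p')" by (simp add: F1_def)
      moreover have "G (circle p' r t) = F1 (circle p' r t)" for t
        using out[of "circle p' r t"] elim G(3) by (simp add: less_imp_le)
      ultimately show ?case by simp
    qed
  qed (use G insert.prems in auto)
  moreover have "G (circle 0 R t) = F1 (circle 0 R t)" for t
  proof (rule G(3), rule ccontr)
    assume "\<not> \<epsilon> \<le> dist p (circle 0 R t)"
    then have "circle 0 R t \<in> cball p \<epsilon>" by simp
    then have "circle 0 R t \<in> ball 0 R" using sub by blast
    then show False using \<open>R > 0\<close> by simp
  qed
  ultimately have "turns (\<lambda>t. F1 (circle 0 R t)) (\<Sum>p\<in>Z. k p)" by simp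
  moreover have "turns (\<lambda>t. P (circle 0 R t)) (k p)"
  proof -
    have "turns (\<lambda>t. circle 0 R t - p) 1" using insert.prems(4) by (intro turns_circle_linear) auto
    from turns_power_int[OF this, of "k p"] show ?thesis by (simp add: P_def)
  qed
  ultimately have "turns (\<lambda>t. F1 (circle 0 R t) * P (circle 0 R t)) ((\<Sum>p\<in>Z. k p) + k p)"
    by (rule turns_mult)
  moreover have "circle 0 R t \<noteq> p" for t
    using insert.prems(4) norm_circle0[of R t] \<open>R > 0\<close> by auto
  ultimately show ?case using insert.hyps by (simp add: F1P add.commute)
qed

section \<open>Evaluation of bivariate polynomials\<close>

definition varx :: bipoly where "varx = [:[:0, 1:]:]"
definition vary :: bipoly where "vary = [:0, 1:]"

lemma eval2_simps [simp]:
  "eval2 0 p = 0" "eval2 1 p = 1" "eval2 (P + Q) p = eval2 P p + eval2 Q p"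
  "eval2 (P - Q) p = eval2 P p - eval2 Q p" "eval2 (- P) p = - eval2 P p"
  "eval2 (P * Q) p = eval2 P p * eval2 Q p" "eval2 (P ^ k) p = eval2 P p ^ k"
  "eval2 (of_nat k) p = of_nat k"
  "eval2 varx p = fst p" "eval2 vary p = snd p" "eval2 [:[:a:]:] p = a"
  by (cases p; simp add: eval2_def poly_power varx_def vary_def)+

lemma eval2_monomials:
  "eval2 P (x, y) = (\<Sum>j\<le>degree P. \<Sum>i\<le>degree (coeff P j). coeff (coeff P j) i * x ^ i * y ^ j)"
  by (simp add: eval2_def poly_altdef[of P] poly_sum poly_power poly_altdef[of "coeff P _"] sum_distrib_right)

lemma continuous_eval2 [continuous_intros]:
  assumes "continuous_on S g"
  shows "continuous_on S (\<lambda>x. eval2 P (g x))"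
proof -
  have "eval2 P (g x) = (\<Sum>j\<le>degree P. \<Sum>i\<le>degree (coeff P j).
      coeff (coeff P j) i * fst (g x) ^ i * snd (g x) ^ j)" for x
    by (metis eval2_monomials prod.collapse)
  then show ?thesis by (simp only:) (intro continuous_intros assms)
qed

lemma poly_zero_if_eval_zero:
  fixes p :: "real poly"
  assumes "\<And>x. x \<noteq> 0 \<Longrightarrow> poly p x = 0"
  shows "p = 0"
proof (rule ccontr)
  assume "p \<noteq> 0"
  then have "finite {x. poly p x = 0}" by (rule poly_roots_finite)
  then have "finite (UNIV - {0 :: real})" by (rule rev_finite_subset) (use assms in auto)
  then show False using infinite_UNIV_char_0[where ?'a = real] by simp
qed

lemma eval2_eq_zeroD:
  assumes "\<And>p. eval2 P p = 0"
  shows "P = 0"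
proof -
  have *: "poly P [:y:] = 0" for y
    using assms[of "(_, y)"] by (intro poly_zero_if_eval_zero) (simp add: eval2_def)
  show ?thesis
  proof (rule ccontr)
    assume "P \<noteq> 0"
    then have "finite {c. poly P c = 0}" by (rule poly_roots_finite)
    then have "finite (range (\<lambda>y :: real. [:y:]))" by (rule rev_finite_subset) (use * in auto)
    then have "finite (UNIV :: real set)" by (rule finite_imageD) (auto simp: inj_def)
    then show False using infinite_UNIV_char_0[where ?'a = real] by simp
  qed
qed

section \<open>Derivations and degrees\<close>

lemma coeff_dx: "coeff (coeff (dx P) j) i = real (Suc i) * coeff (coeff P j) (Suc i)"
  by (simp add: dx_def coeff_map_poly coeff_pderiv)

lemma coeff_of_nat_mult: "coeff (of_nat n * p) i = of_nat n * coeff (p :: real poly) i"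
  by (simp add: of_nat_poly)

lemma coeff_dy: "coeff (coeff (dy P) j) i = real (Suc j) * coeff (coeff P (Suc j)) i"
  by (simp only: dy_def coeff_pderiv coeff_of_nat_mult)

lemma bipoly_eqI: "(\<And>i j. coeff (coeff P j) i = coeff (coeff Q j) i) \<Longrightarrow> P = (Q :: bipoly)"
  by (intro poly_eqI)

lemma dx_dy: "dx (dy P) = dy (dx P)"
  by (rule bipoly_eqI) (simp add: coeff_dx coeff_dy)

lemma dx_add [simp]: "dx (P + Q) = dx P + dx Q"
  by (rule bipoly_eqI) (simp add: coeff_dx algebra_simps)

lemma dy_add [simp]: "dy (P + Q) = dy P + dy Q"
  by (simp add: dy_def pderiv_add)

lemma pderiv_sum: "pderiv (\<Sum>i\<in>I. p i) = (\<Sum>i\<in>I. pderiv (p i :: real poly))"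
  by (induction I rule: infinite_finite_induct) (simp_all add: pderiv_add)

lemma dx_mult: "dx (P * Q) = dx P * Q + P * dx Q"
proof (rule poly_eqI)
  fix j
  have c: "coeff (dx R) i = pderiv (coeff R i)" for R i by (simp add: dx_def coeff_map_poly)
  show "coeff (dx (P * Q)) j = coeff (dx P * Q + P * dx Q) j"
    by (simp add: c coeff_mult pderiv_sum pderiv_mult sum.distrib) (simp add: mult.commute add.commute)
qed

lemma dy_mult: "dy (P * Q) = dy P * Q + P * dy Q"
  by (simp add: dy_def pderiv_mult algebra_simps)

lemma coeff_varx_mult: "coeff (coeff (varx * P) j) i = (if i = 0 then 0 else coeff (coeff P j) (i - 1))"
  by (simp add: varx_def coeff_pCons split: nat.split)

lemma coeff_vary_mult: "coeff (coeff (vary * P) j) i = (if j = 0 then 0 else coeff (coeff P (j - 1)) i)"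
  by (simp add: vary_def coeff_pCons split: nat.split)

definition homogeneous :: "nat \<Rightarrow> bipoly \<Rightarrow> bool" where
  "homogeneous d P \<longleftrightarrow> (\<forall>i j. coeff (coeff P j) i \<noteq> 0 \<longrightarrow> i + j = d)"

text \<open>
  The bound is an integer, so that differentiation lowers it by one without exception; a negative bound
  describes the zero polynomial.
\<close>

definition degree_le :: "int \<Rightarrow> bipoly \<Rightarrow> bool" where
  "degree_le d P \<longleftrightarrow> (\<forall>i j. coeff (coeff P j) i \<noteq> 0 \<longrightarrow> int (i + j) \<le> d)"

lemma homogeneous_dx: "homogeneous d P \<Longrightarrow> homogeneous (d - 1) (dx P)"
  unfolding homogeneous_def coeff_dx by fastforce

lemma homogeneous_dy: "homogeneous d P \<Longrightarrow> homogeneous (d - 1) (dy P)"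
  unfolding homogeneous_def coeff_dy by fastforce

lemma Euler_identity:
  assumes "homogeneous d P"
  shows "varx * dx P + vary * dy P = of_nat d * P"
proof (rule bipoly_eqI)
  fix i j
  have "coeff (coeff (varx * dx P + vary * dy P) j) i = real (i + j) * coeff (coeff P j) i"
    by (simp add: coeff_varx_mult coeff_vary_mult coeff_dx coeff_dy algebra_simps)
  also have "\<dots> = real d * coeff (coeff P j) i"
    using assms unfolding homogeneous_def by (cases "coeff (coeff P j) i = 0") auto
  also have "\<dots> = coeff (coeff (of_nat d * P) j) i" by (simp add: of_nat_poly)
  finally show "coeff (coeff (varx * dx P + vary * dy P) j) i = coeff (coeff (of_nat d * P) j) i" .
qed

lemma eval2_homogeneous:
  assumes "homogeneous d P"
  shows "eval2 P (s * x, s * y) = s ^ d * eval2 P (x, y)"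
proof -
  have "coeff (coeff P j) i * (s * x) ^ i * (s * y) ^ j = s ^ d * (coeff (coeff P j) i * x ^ i * y ^ j)" for i j
  proof (cases "coeff (coeff P j) i = 0")
    case False
    then have "d = i + j" using assms unfolding homogeneous_def by auto
    then show ?thesis by (simp add: power_mult_distrib power_add)
  qed simp
  then show ?thesis unfolding eval2_monomials sum_distrib_left by (intro sum.cong refl) auto
qed

lemma homogeneous_imp_degree_le: "homogeneous d P \<Longrightarrow> int d \<le> k \<Longrightarrow> degree_le k P"
  unfolding homogeneous_def degree_le_def by blast

lemma degree_le_mono: "degree_le d P \<Longrightarrow> d \<le> e \<Longrightarrow> degree_le e P"
  unfolding degree_le_def by force

lemma degree_le_add: "degree_le d P \<Longrightarrow> degree_le d Q \<Longrightarrow> degree_le d (P + Q)"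
  unfolding degree_le_def by (metis add.right_neutral coeff_add)

lemma degree_le_diff: "degree_le d P \<Longrightarrow> degree_le d Q \<Longrightarrow> degree_le d (P - Q)"
  unfolding degree_le_def by (metis coeff_diff diff_zero)

lemma degree_le_mult:
  assumes "degree_le d P" "degree_le e Q"
  shows "degree_le (d + e) (P * Q)"
  unfolding degree_le_def
proof (intro allI impI)
  fix i j
  assume "coeff (coeff (P * Q) j) i \<noteq> 0"
  then have "(\<Sum>b\<le>j. \<Sum>a\<le>i. coeff (coeff P b) a * coeff (coeff Q (j - b)) (i - a)) \<noteq> 0"
    by (simp add: coeff_mult coeff_sum)
  then obtain b where b: "b \<le> j" "(\<Sum>a\<le>i. coeff (coeff P b) a * coeff (coeff Q (j - b)) (i - a)) \<noteq> 0"
    by (metis (no_types, lifting) atMost_iff sum.neutral)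
  then obtain a where a: "a \<le> i" "coeff (coeff P b) a * coeff (coeff Q (j - b)) (i - a) \<noteq> 0"
    by (metis (no_types, lifting) atMost_iff sum.neutral)
  then have nz: "coeff (coeff P b) a \<noteq> 0" "coeff (coeff Q (j - b)) (i - a) \<noteq> 0" by auto
  have "int (a + b) \<le> d"
    using assms(1) nz(1) unfolding degree_le_def by blast
  moreover have "int ((i - a) + (j - b)) \<le> e"
    using assms(2) nz(2) unfolding degree_le_def by blast
  ultimately show "int (i + j) \<le> d + e" using a(1) b(1) by linarith
qed

lemma degree_le_of_nat: "degree_le 0 (of_nat k)"
  unfolding degree_le_def of_nat_poly by (auto simp: coeff_pCons split: nat.splits)

lemma degree_le_dx: "degree_le d P \<Longrightarrow> degree_le (d - 1) (dx P)"
  unfolding degree_le_def coeff_dx by force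

lemma degree_le_dy: "degree_le d P \<Longrightarrow> degree_le (d - 1) (dy P)"
  unfolding degree_le_def coeff_dy by force

lemma degree_le_vars: "degree_le 1 varx" "degree_le 1 vary"
  unfolding degree_le_def varx_def vary_def by (auto simp: coeff_pCons split: nat.splits)

lemma degree_le_bound:
  assumes "degree_le (int d) P"
  obtains C where "C \<ge> 0" "\<And>x y r. r \<ge> 1 \<Longrightarrow> \<bar>x\<bar> \<le> r \<Longrightarrow> \<bar>y\<bar> \<le> r \<Longrightarrow> \<bar>eval2 P (x, y)\<bar> \<le> C * r ^ d"
proof
  let ?C = "\<Sum>j\<le>degree P. \<Sum>i\<le>degree (coeff P j). \<bar>coeff (coeff P j) i\<bar>"
  show "0 \<le> ?C" by (intro sum_nonneg) auto
  fix x y r :: real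
  assume r: "r \<ge> 1" "\<bar>x\<bar> \<le> r" "\<bar>y\<bar> \<le> r"
  have "\<bar>coeff (coeff P j) i * x ^ i * y ^ j\<bar> \<le> \<bar>coeff (coeff P j) i\<bar> * r ^ d" for i j
  proof (cases "coeff (coeff P j) i = 0")
    case False
    then have "i + j \<le> d" using assms unfolding degree_le_def by fastforce
    have "\<bar>x\<bar> ^ i * \<bar>y\<bar> ^ j \<le> r ^ i * r ^ j"
      using r by (intro mult_mono power_mono) auto
    also have "\<dots> = r ^ (i + j)" by (simp add: power_add)
    also have "\<dots> \<le> r ^ d" using r \<open>i + j \<le> d\<close> by (intro power_increasing) auto
    finally show ?thesis by (simp add: abs_mult power_abs mult.assoc mult_left_mono)
  qed simp
  then have "\<bar>eval2 P (x, y)\<bar> \<le> (\<Sum>j\<le>degree P. \<Sum>i\<le>degree (coeff P j). \<bar>coeff (coeff P j) i\<bar> * r ^ d)"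
    unfolding eval2_monomials by (intro order.trans[OF sum_abs] sum_mono) auto
  then show "\<bar>eval2 P (x, y)\<bar> \<le> ?C * r ^ d" by (simp add: sum_distrib_right)
qed

section \<open>Total degree, homogeneous parts and linear factors\<close>

lemma total_degree_exists: "\<exists>d. \<forall>i j. d < i + j \<longrightarrow> coeff (coeff P j) i = (0 :: real)"
proof (intro exI allI impI)
  fix i j
  assume *: "degree P + (\<Sum>j\<le>degree P. degree (coeff P j)) < i + j"
  show "coeff (coeff P j) i = 0"
  proof (cases "j \<le> degree P")
    case True
    then have "degree (coeff P j) \<le> (\<Sum>j\<le>degree P. degree (coeff P j))"
      by (intro member_le_sum) auto
    then have "degree (coeff P j) < i" using * True by linarith
    then show ?thesis by (rule coeff_eq_0)
  next
    case False
    then have "coeff P j = 0" by (intro coeff_eq_0) auto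
    then show ?thesis by simp
  qed
qed

lemma coeff_above_total_degree: "total_degree P < i + j \<Longrightarrow> coeff (coeff P j) i = 0"
proof -
  have "\<forall>i j. total_degree P < i + j \<longrightarrow> coeff (coeff P j) i = 0"
    unfolding total_degree_def by (rule LeastI_ex[OF total_degree_exists])
  then show "total_degree P < i + j \<Longrightarrow> coeff (coeff P j) i = 0" by simp
qed

lemma coeff_hom_part: "coeff (coeff (hom_part d P) j) i = (if i + j = d then coeff (coeff P j) i else 0)"
proof -
  have "coeff (coeff (hom_part d P) j) i = (\<Sum>k\<le>d. if k = j \<and> d - k = i then coeff (coeff P k) (d - k) else 0)"
    unfolding hom_part_def coeff_sum by (intro sum.cong) auto
  also have "\<dots> = (\<Sum>k\<le>d. if k = j then (if d - j = i then coeff (coeff P j) (d - j) else 0) else 0)"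
    by (intro sum.cong) auto
  finally show ?thesis by (auto simp: sum.delta)
qed

lemma homogeneous_hom_part: "homogeneous d (hom_part d P)"
  unfolding homogeneous_def coeff_hom_part by auto

lemma degree_le_remainder:
  assumes "total_degree f = n" "n \<ge> 1"
  shows "degree_le (int n - 2) (f - hom_part n f - hom_part (n - 1) f)"
  unfolding degree_le_def
proof (intro allI impI)
  fix i j
  assume *: "coeff (coeff (f - hom_part n f - hom_part (n - 1) f) j) i \<noteq> 0"
  have "i + j \<le> n"
  proof (rule ccontr)
    assume "\<not> i + j \<le> n"
    then have "coeff (coeff f j) i = 0" using assms by (intro coeff_above_total_degree) auto
    then show False using * by (simp add: coeff_hom_part split: if_splits)
  qed
  moreover have "i + j \<noteq> n" "i + j \<noteq> n - 1" using * assms by (auto simp: coeff_hom_part split: if_splits)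
  ultimately show "int (i + j) \<le> int n - 2" using assms by linarith
qed

lemma total_degree_1E:
  assumes "total_degree l = 1"
  obtains a b c where "l = [:[:a:]:] * varx + [:[:b:]:] * vary + [:[:c:]:]" "a \<noteq> 0 \<or> b \<noteq> 0"
proof -
  let ?a = "coeff (coeff l 0) 1" and ?b = "coeff (coeff l 1) 0" and ?c = "coeff (coeff l 0) 0"
  have hi: "coeff (coeff l j) i = 0" if "i + j > 1" for i j
    using coeff_above_total_degree[of l i j] assms that by simp
  have l: "l = [:[:?a:]:] * varx + [:[:?b:]:] * vary + [:[:?c:]:]"
  proof (rule bipoly_eqI)
    fix i j
    show "coeff (coeff l j) i = coeff (coeff ([:[:?a:]:] * varx + [:[:?b:]:] * vary + [:[:?c:]:]) j) i"
      using hi[of i j] by (auto simp: varx_def vary_def coeff_pCons split: nat.splits)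
  qed
  have "\<not> (?a = 0 \<and> ?b = 0)"
  proof
    assume "?a = 0 \<and> ?b = 0"
    have "\<forall>i j. 0 < i + j \<longrightarrow> coeff (coeff l j) i = 0"
    proof (intro allI impI)
      fix i j :: nat
      assume "0 < i + j"
      then consider "1 < i + j" | "i = 1" "j = 0" | "i = 0" "j = 1" by linarith
      then show "coeff (coeff l j) i = 0"
        using hi \<open>?a = 0 \<and> ?b = 0\<close> by cases auto
    qed
    then have "total_degree l \<le> 0" unfolding total_degree_def by (rule Least_le)
    then show False using assms by simp
  qed
  then show ?thesis by (intro that[OF l]) simp
qed

definition line_through :: "real \<Rightarrow> real \<Rightarrow> bipoly" where
  "line_through a b = [:[:b:]:] * varx - [:[:a:]:] * vary"

lemma total_degree_line_through:
  assumes "a \<noteq> 0 \<or> b \<noteq> 0"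
  shows "total_degree (line_through a b) = 1"
  unfolding total_degree_def
proof (rule Least_equality)
  have c: "coeff (coeff (line_through a b) j) i = (if i = 1 \<and> j = 0 then b else if i = 0 \<and> j = 1 then - a else 0)" for i j
    by (auto simp: line_through_def varx_def vary_def coeff_pCons split: nat.splits)
  show "\<forall>i j. 1 < i + j \<longrightarrow> coeff (coeff (line_through a b) j) i = 0" by (auto simp: c)
  fix d assume d: "\<forall>i j. d < i + j \<longrightarrow> coeff (coeff (line_through a b) j) i = 0"
  show "1 \<le> d"
  proof (rule ccontr)
    assume "\<not> 1 \<le> d"
    then have "coeff (coeff (line_through a b) 0) 1 = 0" "coeff (coeff (line_through a b) 1) 0 = 0"
      using d by auto
    then show False unfolding c using assms by simp
  qed
qed

text \<open>
  A polynomial that vanishes on the line spanned by \<open>(a, b)\<close> is divisible by its equation. The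
  polynomial is a polynomial in \<open>y\<close> over the ring of polynomials in \<open>x\<close>; it has the root \<open>y = (b / a) x\<close> if
  \<open>a \<noteq> 0\<close>, and coefficients divisible by \<open>x\<close> otherwise. Cofactors of forms,
  whose values are known only where the other factor is nonzero, can be treated because the origin is left out.
\<close>

lemma line_through_dvd:
  assumes nz: "a \<noteq> 0 \<or> b \<noteq> 0" and van: "\<And>s. s \<noteq> 0 \<Longrightarrow> eval2 P (s * a, s * b) = 0"
  shows "line_through a b dvd P"
proof (cases "a = 0")
  case True
  then have b: "b \<noteq> 0" using nz by simp
  have "poly (map_poly (\<lambda>p. poly p 0) P) y = 0" if "y \<noteq> 0" for y
  proof -
    have "eval2 P (0, y) = 0" using van[of "y / b"] True b that by simp
    moreover have "poly (poly P [:y:]) 0 = poly (map_poly (\<lambda>p. poly p 0) P) y" for P :: bipoly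
      by (induction P) (simp_all add: map_poly_pCons)
    ultimately show ?thesis by (simp add: eval2_def)
  qed
  then have z: "map_poly (\<lambda>p. poly p 0) P = 0" by (rule poly_zero_if_eval_zero)
  have "[:0, 1:] dvd coeff P j" for j
  proof -
    have "poly (coeff P j) 0 = 0" using arg_cong[OF z, of "\<lambda>q. coeff q j"] by (simp add: coeff_map_poly)
    then show ?thesis by (simp add: poly_eq_0_iff_dvd)
  qed
  then have "varx dvd P" by (simp add: varx_def const_poly_dvd_iff)
  moreover have "line_through a b = [:[:b:]:] * varx" using True by (simp add: line_through_def)
  moreover have "[:[:b:]:] dvd (1 :: bipoly)"
    using b by (intro dvdI[of _ _ "[:[:1 / b:]:]"]) (simp add: one_pCons)
  ultimately show ?thesis by (simp only: mult_unit_dvd_iff')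
next
  case False
  have "poly P [:0, b / a:] = 0"
  proof (rule poly_zero_if_eval_zero)
    fix x :: real assume "x \<noteq> 0"
    then have "eval2 P (x, x * b / a) = 0" using van[of "x / a"] False by simp
    moreover have "poly (poly P [:x * b / a:]) x = poly (poly P [:0, b / a:]) x" for P :: bipoly
      by (induction P) simp_all
    ultimately show "poly (poly P [:0, b / a:]) x = 0" by (simp add: eval2_def)
  qed
  then have dvd: "[:- [:0, b / a:], 1:] dvd P" by (simp add: poly_eq_0_iff_dvd)
  have "line_through a b = [:[:- a:]:] * [:- [:0, b / a:], 1:]"
    using False by (simp add: line_through_def varx_def vary_def)
  moreover have "[:[:- a:]:] dvd (1 :: bipoly)"
    using False by (intro dvdI[of _ _ "[:[:- 1 / a:]:]"]) (simp add: one_pCons)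
  ultimately show ?thesis using dvd by (simp only: mult_unit_dvd_iff')
qed

lemma linear_factor_line_through:
  assumes "a \<noteq> 0 \<or> b \<noteq> 0" "\<And>s. s \<noteq> 0 \<Longrightarrow> eval2 P (s * a, s * b) = 0"
  shows "linear_factor (line_through a b) P"
  using line_through_dvd[OF assms] total_degree_line_through[OF assms(1)] by (simp add: linear_factor_def)

section \<open>Eigenvectors of a pair of binary quadratic forms\<close>

text \<open>
  The pair consists of the positive definite form \<open>E x\<^sup>2 + 2 F x y + G y\<^sup>2\<close> and the form
  \<open>l x\<^sup>2 + 2 m x y + n y\<^sup>2\<close>. The eigenvectors of the second form relative to the first one are the zeros of
  \<open>a x\<^sup>2 + b x y + c y\<^sup>2\<close>, whose discriminant is \<open>D\<close>.
\<close>

locale form_pencil =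
  fixes E F G l m n :: real
  assumes E_pos: "E > 0" and det_pos: "E * G - F\<^sup>2 > 0"
begin

definition a where "a = E * m - F * l"
definition b where "b = E * n - G * l"
definition c where "c = F * n - G * m"
definition \<Delta> where "\<Delta> = E * G - F\<^sup>2"
definition S where "S = l * G + n * E - 2 * m * F"
definition D where "D = b\<^sup>2 - 4 * a * c"

definition eigenspace :: "real \<Rightarrow> (real \<times> real) set" where
  "eigenspace k = {(x, y). (l - k * E) * x + (m - k * F) * y = 0 \<and> (m - k * F) * x + (n - k * G) * y = 0}"

lemma D_eq: "D = S\<^sup>2 - 4 * \<Delta> * (l * n - m\<^sup>2)"
  unfolding D_def S_def \<Delta>_def a_def b_def c_def by algebra

lemma E_sq_D: "E\<^sup>2 * D = (E * b - 2 * a * F)\<^sup>2 + 4 * a\<^sup>2 * \<Delta>"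
  unfolding D_def \<Delta>_def a_def b_def c_def by algebra

lemma D_nonneg: "D \<ge> 0"
proof -
  have "E\<^sup>2 * D \<ge> 0" unfolding E_sq_D using det_pos by (simp add: \<Delta>_def)
  then show ?thesis using E_pos by (simp add: zero_le_mult_iff)
qed

lemma norm_sq_eq: "(a - c)\<^sup>2 + b\<^sup>2 = (a + c)\<^sup>2 + D"
  unfolding D_def by algebra

text \<open>
  As \<open>E\<^sup>2 D\<close> is a sum of squares, \<open>D\<close> vanishes only if \<open>a\<close>, \<open>b\<close> and \<open>c\<close> do. This is why the single
  complex number with components \<open>a - c\<close> and \<open>b\<close> detects double eigenvalues.
\<close>

lemma D_eq_0_iff: "D = 0 \<longleftrightarrow> a - c = 0 \<and> b = 0"
proof
  assume "D = 0"
  then have "(E * b - 2 * a * F)\<^sup>2 + 4 * a\<^sup>2 * \<Delta> = 0" using E_sq_D by simp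
  moreover have "(E * b - 2 * a * F)\<^sup>2 \<ge> 0" "4 * a\<^sup>2 * \<Delta> \<ge> 0" using det_pos by (simp_all add: \<Delta>_def)
  ultimately have "(E * b - 2 * a * F)\<^sup>2 = 0" "4 * a\<^sup>2 * \<Delta> = 0" by linarith+
  then have "a = 0" "b = 0" using det_pos E_pos by (auto simp: \<Delta>_def)
  moreover have "E * c = F * b - G * a" unfolding a_def b_def c_def by algebra
  ultimately show "a - c = 0 \<and> b = 0" using E_pos by simp
next
  assume "a - c = 0 \<and> b = 0"
  then have "D = - 4 * a\<^sup>2" by (simp add: D_def power2_eq_square)
  then show "D = 0" using D_nonneg by (simp add: antisym)
qed

definition root :: "real \<Rightarrow> real" where
  "root \<sigma> = (S + \<sigma> * sqrt D) / (2 * \<Delta>)"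

lemma singular_iff_eigenvector:
  "(\<exists>s \<in> eigenspace k. s \<noteq> 0) \<longleftrightarrow> k = root 1 \<or> k = root (- 1)"
proof -
  have \<Delta>: "\<Delta> > 0" using det_pos by (simp add: \<Delta>_def)
  let ?A = "l - k * E" and ?B = "m - k * F" and ?C = "n - k * G"
  have "(\<exists>s \<in> eigenspace k. s \<noteq> 0) \<longleftrightarrow> ?A * ?C - ?B\<^sup>2 = 0"
  proof
    assume "\<exists>s \<in> eigenspace k. s \<noteq> 0"
    then obtain x y where xy: "?A * x + ?B * y = 0" "?B * x + ?C * y = 0" "x \<noteq> 0 \<or> y \<noteq> 0"
      unfolding eigenspace_def by (auto simp: zero_prod_def)
    have "(?A * ?C - ?B\<^sup>2) * x = 0" "(?A * ?C - ?B\<^sup>2) * y = 0" using xy(1,2) by algebra+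
    then show "?A * ?C - ?B\<^sup>2 = 0" using xy(3) by auto
  next
    assume det: "?A * ?C - ?B\<^sup>2 = 0"
    show "\<exists>s \<in> eigenspace k. s \<noteq> 0"
    proof (cases "?A = 0 \<and> ?B = 0")
      case True
      then have "(1, 0) \<in> eigenspace k" unfolding eigenspace_def by simp
      moreover have "(1, 0) \<noteq> (0 :: real \<times> real)" by (simp add: zero_prod_def)
      ultimately show ?thesis by blast
    next
      case False
      have "(- ?B, ?A) \<in> eigenspace k" unfolding eigenspace_def using det
        by (simp add: power2_eq_square algebra_simps)
      moreover have "(- ?B, ?A) \<noteq> 0" using False by (auto simp: zero_prod_def)
      ultimately show ?thesis by blast
    qed
  qed
  also have "\<dots> \<longleftrightarrow> (2 * \<Delta> * k - S)\<^sup>2 = (sqrt D)\<^sup>2"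
  proof -
    have "(2 * \<Delta> * k - S)\<^sup>2 - D = 4 * \<Delta> * (?A * ?C - ?B\<^sup>2)"
      unfolding D_eq \<Delta>_def S_def by algebra
    then show ?thesis using \<Delta> D_nonneg by auto
  qed
  also have "\<dots> \<longleftrightarrow> 2 * \<Delta> * k - S = sqrt D \<or> 2 * \<Delta> * k - S = - sqrt D"
    by (rule power2_eq_iff)
  also have "\<dots> \<longleftrightarrow> k = root 1 \<or> k = root (- 1)"
    using \<Delta> by (auto simp: root_def field_simps)
  finally show ?thesis .
qed

text \<open>
  Write the vector as a complex number \<open>s\<close>. The real part restates \<open>a x\<^sup>2 + b x y + c y\<^sup>2 = 0\<close>; the
  imaginary part has a sign which tells the larger eigenvalue from the smaller one. So, relative to
  \<open>W = a - c + i b\<close>, the squares \<open>s\<^sup>2\<close> of the eigenvectors of one eigenvalue stay in an open half plane.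
\<close>

lemma eigenvector_square:
  assumes "(x, y) \<in> eigenspace (root \<sigma>)"
  shows "cnj (Complex (a - c) b) * (Complex x y)\<^sup>2
    = of_real (x\<^sup>2 + y\<^sup>2) * Complex (- (a + c)) (\<sigma> * sqrt D)"
proof -
  let ?k = "root \<sigma>"
  have \<Delta>: "\<Delta> > 0" using det_pos by (simp add: \<Delta>_def)
  have e: "(l - ?k * E) * x + (m - ?k * F) * y = 0" "(m - ?k * F) * x + (n - ?k * G) * y = 0"
    using assms by (auto simp: eigenspace_def)
  have k: "\<sigma> * sqrt D = 2 * ?k * \<Delta> - S" using \<Delta> by (simp add: root_def field_simps)
  have "(a - c) * (x\<^sup>2 - y\<^sup>2) + 2 * b * x * y = - (x\<^sup>2 + y\<^sup>2) * (a + c)"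
    using e unfolding a_def b_def c_def by algebra
  moreover have "2 * (a - c) * x * y - b * (x\<^sup>2 - y\<^sup>2) = (x\<^sup>2 + y\<^sup>2) * (\<sigma> * sqrt D)"
    using e unfolding k a_def b_def c_def \<Delta>_def S_def by algebra
  ultimately show ?thesis
    by (simp add: complex_eq_iff power2_eq_square algebra_simps)
qed

text \<open>
  The square of an eigenvector is known up to a positive factor, hence the eigenvector up to a real
  factor.
\<close>

lemma eigenspace_eq_span:
  assumes \<sigma>: "\<sigma> = 1 \<or> \<sigma> = - 1" and W: "Complex (a - c) b \<noteq> 0"
    and \<theta>: "cnj (Complex (a - c) b) * cis (2 * \<theta>) = Complex (- (a + c)) (\<sigma> * sqrt D)"
  shows "eigenspace (root \<sigma>) = span {(cos \<theta>, sin \<theta>)}"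
proof -
  have in_span: "\<exists>r. (x, y) = r *\<^sub>R (cos \<theta>, sin \<theta>)"
    if "(x, y) \<in> eigenspace (root \<sigma>)" for x y
  proof -
    have "cnj (Complex (a - c) b) * (Complex x y)\<^sup>2
        = cnj (Complex (a - c) b) * (of_real (x\<^sup>2 + y\<^sup>2) * cis (2 * \<theta>))"
      unfolding eigenvector_square[OF that] \<theta>[symmetric] by (simp only: mult_ac)
    then have "(Complex x y)\<^sup>2 = of_real (x\<^sup>2 + y\<^sup>2) * cis (2 * \<theta>)" using W by simp
    also have "\<dots> = (of_real (sqrt (x\<^sup>2 + y\<^sup>2)) * cis \<theta>)\<^sup>2"
      unfolding power_mult_distrib of_real_power[symmetric] by (simp add: Complex.DeMoivre)
    finally have "Complex x y = of_real (sqrt (x\<^sup>2 + y\<^sup>2)) * cis \<theta> 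
        \<or> Complex x y = - (of_real (sqrt (x\<^sup>2 + y\<^sup>2)) * cis \<theta>)"
      by (simp only: power2_eq_iff)
    then show ?thesis
      by (elim disjE; intro exI[of _ "sqrt (x\<^sup>2 + y\<^sup>2)"] exI[of _ "- sqrt (x\<^sup>2 + y\<^sup>2)"])
        (auto simp: complex_eq_iff)
  qed
  obtain x y where xy: "(x, y) \<in> eigenspace (root \<sigma>)" "(x, y) \<noteq> (0, 0)"
  proof -
    have "\<exists>s \<in> eigenspace (root \<sigma>). s \<noteq> 0" using singular_iff_eigenvector[of "root \<sigma>"] \<sigma> by auto
    then show ?thesis using that by (auto simp: zero_prod_def)
  qed
  obtain r where r: "(x, y) = r *\<^sub>R (cos \<theta>, sin \<theta>)" using in_span[OF xy(1)] by blast
  have "r \<noteq> 0" using r xy(2) by (cases "r = 0") auto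
  have scale: "q *\<^sub>R s \<in> eigenspace k" if "s \<in> eigenspace k" for q s k
  proof -
    obtain x y where s: "s = (x, y)" by (cases s)
    have e: "(l - k * E) * x + (m - k * F) * y = 0" "(m - k * F) * x + (n - k * G) * y = 0"
      using that unfolding s eigenspace_def by auto
    have "(l - k * E) * (q * x) + (m - k * F) * (q * y) = 0"
      "(m - k * F) * (q * x) + (n - k * G) * (q * y) = 0" using e by algebra+
    then show ?thesis unfolding s eigenspace_def by simp
  qed
  have "q *\<^sub>R (cos \<theta>, sin \<theta>) \<in> eigenspace (root \<sigma>)" for q
    using scale[OF xy(1), of "q / r"] \<open>r \<noteq> 0\<close> unfolding r by simp
  then have "range (\<lambda>q. q *\<^sub>R (cos \<theta>, sin \<theta>)) \<subseteq> eigenspace (root \<sigma>)" by blast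
  moreover have "s \<in> range (\<lambda>q. q *\<^sub>R (cos \<theta>, sin \<theta>))" if "s \<in> eigenspace (root \<sigma>)" for s
    using in_span[of "fst s" "snd s"] that by auto
  ultimately show ?thesis unfolding span_singleton by blast
qed

end

section \<open>Principal directions\<close>

definition p_x where "p_x f z = eval2 (dx f) (Re z, Im z)"
definition p_y where "p_y f z = eval2 (dy f) (Re z, Im z)"
definition p_xx where "p_xx f z = eval2 (dx (dx f)) (Re z, Im z)"
definition p_xy where "p_xy f z = eval2 (dx (dy f)) (Re z, Im z)"
definition p_yy where "p_yy f z = eval2 (dy (dy f)) (Re z, Im z)"

definition form_E where "form_E f z = 1 + (p_x f z)\<^sup>2"
definition form_F where "form_F f z = p_x f z * p_y f z"
definition form_G where "form_G f z = 1 + (p_y f z)\<^sup>2"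

interpretation pencil: form_pencil "form_E f z" "form_F f z" "form_G f z" "p_xx f z" "p_xy f z" "p_yy f z"
  for f z
proof
  show "form_E f z > 0" by (simp add: form_E_def add_pos_nonneg)
  have "form_E f z * form_G f z - (form_F f z)\<^sup>2 = 1 + (p_x f z)\<^sup>2 + (p_y f z)\<^sup>2"
    unfolding form_E_def form_F_def form_G_def by algebra
  then show "form_E f z * form_G f z - (form_F f z)\<^sup>2 > 0"
    by (simp add: add_pos_nonneg)
qed

text \<open>
  The principal directions are the zeros of \<open>a dx\<^sup>2 + b dx dy + c dy\<^sup>2\<close>. Away from umbilics, the
  value of this field is the square of a vector that bisects the angle between the two of them.
\<close>

definition direction_field :: "bipoly \<Rightarrow> complex \<Rightarrow> complex" where
  "direction_field f z = Complex (pencil.a f z - pencil.c f z) (pencil.b f z)"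

text \<open>
  The second fundamental form is the Hessian up to the positive factor \<open>\<kappa>\<close>, which rescales the
  principal curvatures but affects neither their order nor the principal directions.
\<close>

lemma graph_forms:
  fixes f z
  defines "\<kappa> \<equiv> 1 / sqrt (1 + (p_x f z)\<^sup>2 + (p_y f z)\<^sup>2)"
  shows "first_form f (Re z, Im z) (x, y) (u, v)
      = form_E f z * x * u + form_F f z * (x * v + y * u) + form_G f z * y * v"
    and "second_form f (Re z, Im z) (x, y) (u, v)
      = \<kappa> * (p_xx f z * x * u + p_xy f z * (x * v + y * u) + p_yy f z * y * v)"
    and "\<kappa> > 0"
proof -
  show "first_form f (Re z, Im z) (x, y) (u, v)
      = form_E f z * x * u + form_F f z * (x * v + y * u) + form_G f z * y * v"
    unfolding first_form_def graph_tangent_def form_E_def form_F_def form_G_def p_x_def p_y_def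
    by (simp add: power2_eq_square algebra_simps)
  have "norm (- p_x f z, - p_y f z, 1 :: real) = sqrt (1 + (p_x f z)\<^sup>2 + (p_y f z)\<^sup>2)"
    by (simp add: norm_prod_def real_sqrt_pow2 add_ac)
  then have "unit_normal f (Re z, Im z) = \<kappa> *\<^sub>R (- p_x f z, - p_y f z, 1)"
    unfolding unit_normal_def sgn_div_norm \<kappa>_def p_x_def p_y_def by (simp add: divide_inverse)
  then show "second_form f (Re z, Im z) (x, y) (u, v)
      = \<kappa> * (p_xx f z * x * u + p_xy f z * (x * v + y * u) + p_yy f z * y * v)"
    by (simp add: second_form_def p_xx_def p_xy_def p_yy_def algebra_simps)
  show "\<kappa> > 0" unfolding \<kappa>_def by (simp add: add_pos_nonneg)
qed

lemma principal_data:
  obtains \<kappa> where "\<kappa> > 0" "max_curvature f (Re z, Im z) = \<kappa> * pencil.root f z 1"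
    "min_curvature f (Re z, Im z) = \<kappa> * pencil.root f z (- 1)"
    "max_direction f (Re z, Im z) = pencil.eigenspace f z (pencil.root f z 1)"
    "min_direction f (Re z, Im z) = pencil.eigenspace f z (pencil.root f z (- 1))"
proof -
  define \<kappa> where "\<kappa> = 1 / sqrt (1 + (p_x f z)\<^sup>2 + (p_y f z)\<^sup>2)"
  have \<kappa>: "\<kappa> > 0" unfolding \<kappa>_def by (rule graph_forms(3))
  note forms = graph_forms(1,2)[of f z, folded \<kappa>_def]
  have eig: "curvature_eigenspace f (Re z, Im z) (\<kappa> * k) = pencil.eigenspace f z k" for k
  proof -
    have "(\<forall>t. second_form f (Re z, Im z) (x, y) t = \<kappa> * k * first_form f (Re z, Im z) (x, y) t)
      \<longleftrightarrow> (p_xx f z - k * form_E f z) * x + (p_xy f z - k * form_F f z) * y = 0 \<and>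
          (p_xy f z - k * form_F f z) * x + (p_yy f z - k * form_G f z) * y = 0"
      (is "?L \<longleftrightarrow> ?P = 0 \<and> ?Q = 0") for x y
    proof -
      have "second_form f (Re z, Im z) (x, y) (u, v) - \<kappa> * k * first_form f (Re z, Im z) (x, y) (u, v)
          = \<kappa> * (?P * u + ?Q * v)" for u v
        unfolding forms by (simp add: algebra_simps)
      then have "second_form f (Re z, Im z) (x, y) (u, v) = \<kappa> * k * first_form f (Re z, Im z) (x, y) (u, v)
          \<longleftrightarrow> ?P * u + ?Q * v = 0" for u v using \<kappa> by (smt (verit) mult_eq_0_iff)
      then have "?L \<longleftrightarrow> (\<forall>u v. ?P * u + ?Q * v = 0)" by (simp only: split_paired_All)
      also have "\<dots> \<longleftrightarrow> ?P = 0 \<and> ?Q = 0"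
      proof
        assume "\<forall>u v. ?P * u + ?Q * v = 0"
        from this[rule_format, of 1 0] this[rule_format, of 0 1] show "?P = 0 \<and> ?Q = 0" by simp
      qed auto
      finally show ?thesis .
    qed
    then show ?thesis unfolding curvature_eigenspace_def pencil.eigenspace_def by auto
  qed
  have "principal_curvatures f (Re z, Im z) = {\<kappa> * pencil.root f z 1, \<kappa> * pencil.root f z (- 1)}"
  proof -
    have "k \<in> principal_curvatures f (Re z, Im z) \<longleftrightarrow> 
        k / \<kappa> = pencil.root f z 1 \<or> k / \<kappa> = pencil.root f z (- 1)" for k
      unfolding pencil.singular_iff_eigenvector[symmetric] eig[symmetric] principal_curvatures_def
      using \<kappa> by simp
    then show ?thesis using \<kappa> by (auto simp: field_simps)
  qed
  moreover have "\<kappa> * pencil.root f z (- 1) \<le> \<kappa> * pencil.root f z 1"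
  proof -
    have "pencil.\<Delta> f z > 0" using pencil.det_pos[of f z] by (simp add: pencil.\<Delta>_def)
    then have "pencil.root f z (- 1) \<le> pencil.root f z 1"
      using pencil.D_nonneg[of f z] by (simp add: pencil.root_def divide_right_mono)
    then show ?thesis using \<kappa> by simp
  qed
  ultimately have "max_curvature f (Re z, Im z) = \<kappa> * pencil.root f z 1"
    "min_curvature f (Re z, Im z) = \<kappa> * pencil.root f z (- 1)"
    by (simp_all add: max_curvature_def min_curvature_def max_absorb1 min_absorb2)
  then show ?thesis using that[OF \<kappa>] eig by (simp add: max_direction_def min_direction_def)
qed

lemma umbilic_iff: "(Re z, Im z) \<in> umbilics f \<longleftrightarrow> direction_field f z = 0"
proof -
  obtain \<kappa> where \<kappa>: "\<kappa> > 0" "max_curvature f (Re z, Im z) = \<kappa> * pencil.root f z 1"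
    "min_curvature f (Re z, Im z) = \<kappa> * pencil.root f z (- 1)"
    by (rule principal_data[of f z]) blast
  have "pencil.\<Delta> f z > 0" using pencil.det_pos[of f z] by (simp add: pencil.\<Delta>_def)
  then have "(Re z, Im z) \<in> umbilics f \<longleftrightarrow> pencil.D f z = 0"
    using \<kappa> by (simp add: umbilics_def pencil.root_def)
  also have "\<dots> \<longleftrightarrow> direction_field f z = 0"
    by (simp add: pencil.D_eq_0_iff direction_field_def complex_eq_iff)
  finally show ?thesis .
qed

lemma continuous_eval2_complex: "continuous_on S (\<lambda>z. eval2 P (Re z, Im z))"
  by (intro continuous_intros)

lemmas continuous_partials [continuous_intros] =
  continuous_eval2_complex[of _ "dx _", folded p_x_def] continuous_eval2_complex[of _ "dy _", folded p_y_def]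
  continuous_eval2_complex[of _ "dx (dx _)", folded p_xx_def]
  continuous_eval2_complex[of _ "dx (dy _)", folded p_xy_def]
  continuous_eval2_complex[of _ "dy (dy _)", folded p_yy_def]

lemma continuous_form_coeffs:
  "continuous_on S (pencil.a f)" "continuous_on S (pencil.b f)" "continuous_on S (pencil.c f)"
  "continuous_on S (pencil.D f)"
  unfolding pencil.D_def
  unfolding pencil.a_def pencil.b_def pencil.c_def
  unfolding form_E_def form_F_def form_G_def
  by (intro continuous_intros)+

lemma continuous_direction_field: "continuous_on S (direction_field f)"
  unfolding direction_field_def
  by (intro continuous_on_Complex continuous_intros continuous_form_coeffs)

section \<open>Index of the fields of principal directions\<close>

lemma has_line_index_unique:
  assumes "has_line_index \<Lambda> p i" "has_line_index \<Lambda> p j"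
  shows "i = j"
proof -
  let ?c = "\<lambda>r t. p + r *\<^sub>R (cos (2 * pi * t), sin (2 * pi * t))"
  have "\<forall>\<^sub>F r :: real in at_right 0. i = j"
    using assms[unfolded has_line_index_def]
  proof eventually_elim
    case (elim r)
    obtain \<theta> where \<theta>: "continuous_on {0..1} \<theta>"
      "\<And>t. t \<in> {0..1} \<Longrightarrow> \<Lambda> (?c r t) = span {(cos (\<theta> t), sin (\<theta> t))}" "\<theta> 1 - \<theta> 0 = 2 * pi * i"
      using elim(1) by blast
    obtain \<eta> where \<eta>: "continuous_on {0..1} \<eta>"
      "\<And>t. t \<in> {0..1} \<Longrightarrow> \<Lambda> (?c r t) = span {(cos (\<eta> t), sin (\<eta> t))}" "\<eta> 1 - \<eta> 0 = 2 * pi * j"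
      using elim(2) by blast
    define d where "d = (\<lambda>t. complex_of_real ((\<theta> t - \<eta> t) / pi))"
    have ints: "d t \<in> \<int>" if t: "t \<in> {0..1}" for t
    proof -
      have "(cos (\<theta> t), sin (\<theta> t)) \<in> span {(cos (\<eta> t), sin (\<eta> t))}"
        using \<theta>(2)[OF t] \<eta>(2)[OF t] span_base by blast
      then obtain q where q: "cos (\<theta> t) = q * cos (\<eta> t)" "sin (\<theta> t) = q * sin (\<eta> t)"
        unfolding span_singleton by auto
      have "sin (\<theta> t - \<eta> t) = 0" unfolding sin_diff q by simp
      then obtain k :: int where "\<theta> t - \<eta> t = of_int k * pi" using sin_zero_iff_int2 by blast
      then have "d t = of_int k" unfolding d_def by simp
      then show ?thesis by simp
    qed
    have cont: "continuous_on {0..1} d"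
      unfolding d_def using \<theta>(1) \<eta>(1) by (intro continuous_intros) auto
    obtain k where k: "\<And>t. t \<in> {0..1} \<Longrightarrow> d t = of_int k"
      by (rule integer_valued_constant[OF _ cont ints]) auto
    then have "d 1 = d 0" by simp
    then have "\<theta> 1 - \<eta> 1 = \<theta> 0 - \<eta> 0"
      unfolding d_def of_real_eq_iff by simp
    then have "2 * pi * i = 2 * pi * j" using \<theta>(3) \<eta>(3) by linarith
    then show ?case by simp
  qed
  then show ?thesis by (simp add: trivial_limit_at_right_real)
qed

lemma line_index_eqI: "has_line_index \<Lambda> p i \<Longrightarrow> line_index \<Lambda> p = i"
  unfolding line_index_def using has_line_index_unique by blast

text \<open>
  A lift of the angle of the line is half of the sum of a lift of the argument of \<open>W\<close> and of \<open>Arg U\<close>. The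
  latter is continuous and periodic as \<open>U\<close> avoids the real axis.
\<close>

lemma has_line_index_half_turns:
  fixes W U :: "complex \<Rightarrow> complex"
  assumes turns: "\<forall>\<^sub>F r in at_right 0. turns (\<lambda>t. W (circle p r t)) k"
    and U: "continuous_on UNIV U" "\<And>z. W z \<noteq> 0 \<Longrightarrow> Im (U z) \<noteq> 0" "\<And>z. cmod (U z) = cmod (W z)"
    and \<Lambda>: "\<And>z \<theta>. W z \<noteq> 0 \<Longrightarrow> cnj (W z) * cis (2 * \<theta>) = U z \<Longrightarrow>
        \<Lambda> (Re z, Im z) = span {(cos \<theta>, sin \<theta>)}"
  shows "has_line_index \<Lambda> (Re p, Im p) (real_of_int k / 2)"
  unfolding has_line_index_def
  using turns
proof eventually_elim
  case (elim r)
  obtain q where q: "continuous_on UNIV q" "\<And>t. W (circle p r t) = exp (q t)"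
      "\<And>t. q (t + 2 * pi) = q t + of_int k * (2 * of_real pi * \<i>)"
    using elim unfolding turns_def by blast
  define \<theta> where "\<theta> = (\<lambda>t. (Im (q (2 * pi * t)) + Arg (U (circle p r (2 * pi * t)))) / 2)"
  have W: "W (circle p r t) \<noteq> 0" for t using q(2) by simp
  show ?case
  proof (intro exI conjI ballI)
    have "U (circle p r t) \<notin> \<real>\<^sub>\<le>\<^sub>0" for t
      using U(2)[OF W] by (auto simp: complex_nonpos_Reals_iff)
    then have "isCont Arg (U (circle p r t))" for t by (rule continuous_at_Arg)
    then have Arg: "continuous_on (range (\<lambda>t. U (circle p r t))) Arg"
      by (intro continuous_at_imp_continuous_on) auto
    have "continuous_on UNIV (\<lambda>t. U (circle p r t))"
      by (rule continuous_on_compose2[OF U(1)]) (intro continuous_intros, simp)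
    then have "continuous_on UNIV (\<lambda>t. Arg (U (circle p r t)))"
      by (rule continuous_on_compose2[OF Arg]) simp
    from continuous_on_add[OF continuous_on_Im[OF q(1)] this]
    have "continuous_on UNIV (\<lambda>t. Im (q t) + Arg (U (circle p r t)))" .
    then have "continuous_on {0..1} (\<lambda>t. Im (q (2 * pi * t)) + Arg (U (circle p r (2 * pi * t))))"
      by (rule continuous_on_compose2) (intro continuous_intros, simp)
    then show "continuous_on {0..1} \<theta>"
      unfolding \<theta>_def by (rule continuous_on_divide) auto
    show "\<theta> 1 - \<theta> 0 = 2 * pi * (real_of_int k / 2)"
      using q(3)[of 0] circle_periodic[of p r 0] by (simp add: \<theta>_def field_simps)
    fix t :: real
    let ?z = "circle p r (2 * pi * t)"
    have z: "(Re p, Im p) + r *\<^sub>R (cos (2 * pi * t), sin (2 * pi * t)) = (Re ?z, Im ?z)"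
      by (simp add: circle_def)
    have nz: "W ?z \<noteq> 0" by (rule W)
    have 1: "of_real (cmod (W ?z)) * cis (Im (q (2 * pi * t))) = W ?z"
      unfolding q(2) exp_eq_polar[of "q (2 * pi * t)"] by (simp add: norm_mult)
    have 2: "of_real (cmod (U ?z)) * cis (Arg (U ?z)) = U ?z"
      using rcis_cmod_Arg by (simp add: rcis_def)
    have e: "2 * \<theta> t = Im (q (2 * pi * t)) + Arg (U ?z)" by (simp add: \<theta>_def)
    have "of_real (cmod (W ?z)) * of_real (cmod (U ?z)) * cis (2 * \<theta> t)
        = (of_real (cmod (W ?z)) * cis (Im (q (2 * pi * t)))) * (of_real (cmod (U ?z)) * cis (Arg (U ?z)))"
      unfolding e cis_mult[symmetric] by (simp only: mult_ac)
    then have "of_real (cmod (W ?z)) * of_real (cmod (U ?z)) * cis (2 * \<theta> t) = W ?z * U ?z"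
      unfolding 1 2 .
    then have "(W ?z * cnj (W ?z)) * cis (2 * \<theta> t) = W ?z * U ?z"
      by (simp add: U(3) complex_norm_square[symmetric] power2_eq_square)
    then have "cnj (W ?z) * cis (2 * \<theta> t) = U ?z" using nz by simp
    from \<Lambda>[OF nz this]
    show "\<Lambda> ((Re p, Im p) + r *\<^sub>R (cos (2 * pi * t), sin (2 * pi * t))) = span {(cos (\<theta> t), sin (\<theta> t))}"
      unfolding z .
  qed
qed

text \<open>
  Both fields have the same index because the two values of \<open>U\<close> are complex conjugates of each other, and
  each of them stays in a half plane.
\<close>

lemma principal_index:
  assumes "\<forall>\<^sub>F r in at_right 0. turns (\<lambda>t. direction_field f (circle p r t)) k"
  shows "line_index (max_direction f) (Re p, Im p) = real_of_int k / 2"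
    and "line_index (min_direction f) (Re p, Im p) = real_of_int k / 2"
proof -
  define U where "U = (\<lambda>\<sigma> z. Complex (- (pencil.a f z + pencil.c f z)) (\<sigma> * sqrt (pencil.D f z)))"
  have contU: "continuous_on UNIV (U \<sigma>)" for \<sigma>
    unfolding U_def by (intro continuous_on_Complex continuous_intros continuous_form_coeffs)
  have ImU: "Im (U \<sigma> z) \<noteq> 0" if "direction_field f z \<noteq> 0" "\<sigma> = 1 \<or> \<sigma> = - 1" for \<sigma> z
  proof -
    have "pencil.D f z \<noteq> 0"
      using that(1) by (auto simp: pencil.D_eq_0_iff direction_field_def complex_eq_iff)
    then show ?thesis using that(2) by (auto simp: U_def)
  qed
  have normU: "cmod (U \<sigma> z) = cmod (direction_field f z)" if "\<sigma> = 1 \<or> \<sigma> = - 1" for \<sigma> z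
  proof -
    have "\<sigma>\<^sup>2 = 1" using that by auto
    then show ?thesis
      using pencil.norm_sq_eq[of f z] pencil.D_nonneg[of f z]
      by (simp add: U_def direction_field_def cmod_def power_mult_distrib del: minus_add_distrib)
  qed
  have span: "pencil.eigenspace f z (pencil.root f z \<sigma>) = span {(cos \<theta>, sin \<theta>)}"
    if "direction_field f z \<noteq> 0" "cnj (direction_field f z) * cis (2 * \<theta>) = U \<sigma> z" "\<sigma> = 1 \<or> \<sigma> = - 1" for \<sigma> z \<theta>
    using pencil.eigenspace_eq_span[of \<sigma> f z \<theta>] that unfolding direction_field_def U_def by simp
  have dir: "max_direction f (Re z, Im z) = pencil.eigenspace f z (pencil.root f z 1)"
    "min_direction f (Re z, Im z) = pencil.eigenspace f z (pencil.root f z (- 1))" for z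
    by (rule principal_data[of f z]; simp)+
  have "has_line_index (max_direction f) (Re p, Im p) (real_of_int k / 2)"
    by (rule has_line_index_half_turns[OF assms contU[of 1]])
      (auto simp: ImU normU span dir)
  then show "line_index (max_direction f) (Re p, Im p) = real_of_int k / 2" by (rule line_index_eqI)
  have "has_line_index (min_direction f) (Re p, Im p) (real_of_int k / 2)"
    by (rule has_line_index_half_turns[OF assms contU[of "- 1"]])
      (auto simp: ImU normU span dir)
  then show "line_index (min_direction f) (Re p, Im p) = real_of_int k / 2" by (rule line_index_eqI)
qed

section \<open>Loops on large circles\<close>

text \<open>
  Compactness of one period.
\<close>

lemma loop_lower_bound:
  assumes "nonvanishing_loop \<phi>"
  obtains \<delta> where "\<delta> > 0" "\<And>t. \<delta> \<le> cmod (\<phi> t)"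
proof -
  have cont: "continuous_on {0..2 * pi} (\<lambda>t. cmod (\<phi> t))"
    using assms unfolding nonvanishing_loop_def
    by (intro continuous_on_norm) (auto intro: continuous_on_subset)
  have "\<exists>s \<in> {0..2 * pi}. \<forall>t \<in> {0..2 * pi}. cmod (\<phi> s) \<le> cmod (\<phi> t)"
    by (rule continuous_attains_inf[OF _ _ cont]) auto
  then obtain s where s: "\<And>t. t \<in> {0..2 * pi} \<Longrightarrow> cmod (\<phi> s) \<le> cmod (\<phi> t)"
    by blast
  have "cmod (\<phi> s) \<le> cmod (\<phi> t)" for t
  proof -
    obtain k :: int where "of_int k \<le> t / (2 * pi)" "t / (2 * pi) < of_int k + 1"
      by (rule that[of "\<lfloor>t / (2 * pi)\<rfloor>"]) linarith+
    then have "t + 2 * pi * of_int (- k) \<in> {0..2 * pi}"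
      by (simp add: field_simps)
    from s[OF this] show ?thesis
      using periodic_int[of \<phi> t "- k"] assms unfolding nonvanishing_loop_def by simp
  qed
  moreover have "cmod (\<phi> s) > 0" using assms unfolding nonvanishing_loop_def by simp
  ultimately show ?thesis using that by blast
qed

text \<open>
  A family of paths inherits the turning number of its leading term for large radii, together with a
  lower bound of the same order.
\<close>

lemma turns_leading_term:
  assumes \<phi>: "turns \<phi> j"
    and \<Psi>: "\<And>r. continuous_on UNIV (\<Psi> r)" "\<And>r t. \<Psi> r (t + 2 * pi) = \<Psi> r t"
    and C: "\<And>r t. r \<ge> 1 \<Longrightarrow> cmod (\<Psi> r t - of_real (r ^ Suc d) * \<phi> t) \<le> C * r ^ d"
  obtains \<delta> R where "\<delta> > 0" "R \<ge> 1" "\<And>r. r \<ge> R \<Longrightarrow> turns (\<Psi> r) j"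
    "\<And>r t. r \<ge> R \<Longrightarrow> \<delta> * r ^ Suc d \<le> cmod (\<Psi> r t)"
proof -
  obtain \<epsilon> where \<epsilon>: "\<epsilon> > 0" "\<And>t. \<epsilon> \<le> cmod (\<phi> t)"
    using loop_lower_bound[OF turns_imp_loop[OF \<phi>]] by blast
  \<comment> \<open>From this radius on the error is less than half of the leading term.\<close>
  define R where "R = max 1 (2 * C / \<epsilon> + 1)"
  have close: "cmod (\<Psi> r t - of_real (r ^ Suc d) * \<phi> t) < \<epsilon> / 2 * r ^ Suc d"
    and main: "\<epsilon> * r ^ Suc d \<le> cmod (of_real (r ^ Suc d) * \<phi> t)"
    and pos: "r ^ Suc d > 0"
    if "r \<ge> R" for r t
  proof -
    have r: "r \<ge> 1" "r > 2 * C / \<epsilon>" using that by (auto simp: R_def)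
    then show "r ^ Suc d > 0" by simp
    have "C < \<epsilon> / 2 * r" using r(2) \<epsilon>(1) by (simp add: field_simps)
    then have "C * r ^ d < \<epsilon> / 2 * r * r ^ d" using r(1) by (intro mult_strict_right_mono) auto
    then show "cmod (\<Psi> r t - of_real (r ^ Suc d) * \<phi> t) < \<epsilon> / 2 * r ^ Suc d"
      using C[OF r(1), of t] by (simp add: mult_ac)
    show "\<epsilon> * r ^ Suc d \<le> cmod (of_real (r ^ Suc d) * \<phi> t)"
      using \<epsilon>(2)[of t] r(1) unfolding norm_mult norm_of_real
      by (simp add: mult.commute mult_left_mono)
  qed
  show ?thesis
  proof
    show "\<epsilon> / 2 > 0" "R \<ge> 1" using \<epsilon> by (auto simp: R_def)
    fix r :: real assume r: "r \<ge> R"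
    have bound: "cmod (\<Psi> r t - of_real (r ^ Suc d) * \<phi> t) < cmod (of_real (r ^ Suc d) * \<phi> t)" for t
      using close[OF r, of t] main[OF r, of t] mult_pos_pos[OF \<epsilon>(1) pos[OF r]] by linarith
    have "turns (\<lambda>t. of_real (r ^ Suc d) * \<phi> t) (0 + j)"
      using pos[OF r] by (intro turns_mult turns_const \<phi>) (metis of_real_eq_0_iff less_irrefl)
    then have "turns (\<lambda>t. of_real (r ^ Suc d) * \<phi> t) j" by simp
    then show "turns (\<Psi> r) j" by (rule turns_Rouche[OF _ \<Psi> bound])
    show "\<epsilon> / 2 * r ^ Suc d \<le> cmod (\<Psi> r t)" for t
    proof -
      have "cmod (of_real (r ^ Suc d) * \<phi> t) - cmod (\<Psi> r t) \<le> cmod (\<Psi> r t - of_real (r ^ Suc d) * \<phi> t)"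
        by (metis norm_minus_commute norm_triangle_ineq2)
      then show ?thesis using close[OF r, of t] main[OF r, of t] by linarith
    qed
  qed
qed

lemma turns_real:
  assumes "nonvanishing_loop (\<lambda>t. of_real (u t))"
  shows "turns (\<lambda>t. of_real (u t)) 0"
proof -
  obtain k where k: "turns (\<lambda>t. of_real (u t)) k" using turns_exists[OF assms] .
  have "k = - k" by (rule turns_unique[OF k]) (use turns_cnj[OF k] in simp)
  then show ?thesis using k by simp
qed

definition pt :: "real \<Rightarrow> real \<times> real" where "pt t = (cos t, sin t)"

lemma pt_periodic [simp]: "pt (t + 2 * pi) = pt t" by (simp add: pt_def)

lemma continuous_pt [continuous_intros]: "continuous_on S pt"
  unfolding pt_def by (intro continuous_intros)

lemma pt_nonzero: "fst (pt t) \<noteq> 0 \<or> snd (pt t) \<noteq> 0"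
  using cis_neq_zero[of t] by (auto simp: pt_def complex_eq_iff simp del: cis_neq_zero)

section \<open>Turning number of the gradient of a form\<close>

text \<open>
  The derivative along the angle.
\<close>

definition rot :: "bipoly \<Rightarrow> bipoly" where
  "rot P = varx * dy P - vary * dx P"

lemma rot_mult: "rot (P * Q) = rot P * Q + P * rot Q"
  unfolding rot_def dx_mult dy_mult by (simp add: algebra_simps)

text \<open>
  For a form of degree \<open>m\<close>, by Euler's identity, the gradient on the unit circle in the polar frame. The
  number \<open>m\<close> is kept fixed while linear factors are split off, which is why it is an independent parameter.
\<close>

definition polar_gradient :: "real \<Rightarrow> bipoly \<Rightarrow> real \<Rightarrow> complex" where
  "polar_gradient m P t = Complex (m * eval2 P (pt t)) (eval2 (rot P) (pt t))"

lemma continuous_polar_gradient: "continuous_on S (polar_gradient m P)"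
  unfolding polar_gradient_def by (intro continuous_on_Complex continuous_intros)

lemma polar_gradient_periodic: "polar_gradient m P (t + 2 * pi) = polar_gradient m P t"
  by (simp add: polar_gradient_def)

definition linear_form :: "real \<Rightarrow> real \<Rightarrow> bipoly" where
  "linear_form a b = [:[:a:]:] * varx + [:[:b:]:] * vary"

lemma eval2_linear_form [simp]: "eval2 (linear_form a b) p = a * fst p + b * snd p"
  by (simp add: linear_form_def del: mult_pCons_left)

lemma dx_linear_form: "dx (linear_form a b) = [:[:a:]:]" and dy_linear_form: "dy (linear_form a b) = [:[:b:]:]"
  by (rule bipoly_eqI; auto simp: coeff_dx coeff_dy linear_form_def varx_def vary_def coeff_pCons split: nat.splits)+

lemma polar_gradient_linear_form:
  "polar_gradient 1 (linear_form a b) t = Complex a b * cnj (cis t)"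
  by (simp add: polar_gradient_def rot_def dx_linear_form dy_linear_form pt_def complex_eq_iff
      algebra_simps del: mult_pCons_left mult_pCons_right)

text \<open>
  Each linear factor contributes a negative turn. The polar gradient of \<open>l h\<close>, with
  \<open>s\<close>, \<open>c\<close>, \<open>u\<close>, \<open>v\<close> the values of \<open>l\<close>, \<open>rot l\<close>, \<open>h\<close>, \<open>rot h\<close>, is compared with the product
  \<open>(m u + i v) (s + i c)\<close>, whose second factor is a constant times \<open>exp (- i t)\<close>. The real part of the one times the
  conjugate of the other is \<open>m\<^sup>2 s\<^sup>2 u\<^sup>2 + m c\<^sup>2 u\<^sup>2 + c u s v + s\<^sup>2 v\<^sup>2\<close>, a definite quadratic form in \<open>s u\<close>, \<open>c u\<close>
  and \<open>s v\<close> because \<open>m > 1 / 4\<close>.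
\<close>

lemma turns_polar_gradient_times_linear:
  assumes m: "m \<ge> 1" and ab: "a \<noteq> 0 \<or> b \<noteq> 0" and h: "turns (polar_gradient m h) k"
    and nz: "\<And>t. polar_gradient m (linear_form a b * h) t \<noteq> 0"
  shows "turns (polar_gradient m (linear_form a b * h)) (k - 1)"
proof (rule turns_transfer[where c = 1])
  have "turns (\<lambda>t. Complex a b * cnj (cis t)) (0 + - 1)"
    using ab by (intro turns_mult turns_const turns_cnj turns_cis) (auto simp: complex_eq_iff)
  then have l: "turns (polar_gradient 1 (linear_form a b)) (- 1)"
    by (simp add: polar_gradient_linear_form[abs_def])
  show "turns (\<lambda>t. polar_gradient m h t * polar_gradient 1 (linear_form a b) t) (k - 1)"
    using turns_mult[OF h l] by simp
  show "nonvanishing_loop (polar_gradient m (linear_form a b * h))"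
    unfolding nonvanishing_loop_def using nz continuous_polar_gradient polar_gradient_periodic by blast
  fix t
  define s where "s = eval2 (linear_form a b) (pt t)"
  define c where "c = eval2 (rot (linear_form a b)) (pt t)"
  define u where "u = eval2 h (pt t)"
  define v where "v = eval2 (rot h) (pt t)"
  have sc: "s \<noteq> 0 \<or> c \<noteq> 0"
  proof -
    have "polar_gradient 1 (linear_form a b) t \<noteq> 0"
      using turns_imp_loop[OF l] unfolding nonvanishing_loop_def by blast
    then show ?thesis by (auto simp: polar_gradient_def s_def c_def complex_eq_iff simp del: eval2_linear_form)
  qed
  have X: "polar_gradient m (linear_form a b * h) t = Complex (m * s * u) (c * u + s * v)"
    by (simp add: polar_gradient_def rot_mult s_def c_def u_def v_def del: eval2_linear_form)
  \<comment> \<open>The quadratic form of the comparison, with the square in \<open>s v\<close> completed.\<close>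
  let ?q = "m\<^sup>2 * (s * u)\<^sup>2 + (m - 1 / 4) * (c * u)\<^sup>2 + (s * v + c * u / 2)\<^sup>2"
  have "Re (1 * cnj (polar_gradient m h t * polar_gradient 1 (linear_form a b) t)
      * polar_gradient m (linear_form a b * h) t) = ?q"
    unfolding X by (simp add: polar_gradient_def s_def[symmetric] c_def[symmetric]
      u_def[symmetric] v_def[symmetric] power2_eq_square field_simps
      del: eval2_linear_form)
  moreover have "?q > 0"
  proof (rule ccontr)
    assume "\<not> ?q > 0"
    moreover have "m\<^sup>2 * (s * u)\<^sup>2 \<ge> 0" "(m - 1 / 4) * (c * u)\<^sup>2 \<ge> 0" "(s * v + c * u / 2)\<^sup>2 \<ge> 0"
      using m by simp_all
    ultimately have "m\<^sup>2 * (s * u)\<^sup>2 = 0" "(m - 1 / 4) * (c * u)\<^sup>2 = 0" "(s * v + c * u / 2)\<^sup>2 = 0"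
      by linarith+
    then have "s * u = 0" "c * u = 0" "s * v = 0" using m by auto
    then have "Complex (m * s * u) (c * u + s * v) = 0" by (auto simp: complex_eq_iff)
    then show False using nz[of t] X by simp
  qed
  ultimately show "0 < Re (1 * cnj (polar_gradient m h t * polar_gradient 1 (linear_form a b) t)
      * polar_gradient m (linear_form a b * h) t)" by simp
qed

text \<open>
  In the base case the real part of the polar gradient is a positive multiple of \<open>h\<close>, which has no zero.
\<close>

lemma turns_polar_gradient_product:
  assumes m: "m \<ge> 1" and ls: "\<forall>l \<in> set ls. \<exists>a b. (a \<noteq> 0 \<or> b \<noteq> 0) \<and> l = linear_form a b"
    and h: "\<And>t. eval2 h (pt t) \<noteq> 0"
    and nz: "\<And>t. polar_gradient m (prod_list ls * h) t \<noteq> 0"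
  shows "turns (polar_gradient m (prod_list ls * h)) (- int (length ls))"
  using ls nz
proof (induction ls)
  case Nil
  have "turns (polar_gradient m h) 0"
  proof (rule turns_transfer[where c = 1])
    show "turns (\<lambda>t. of_real (eval2 h (pt t))) 0"
      by (rule turns_real) (auto simp: nonvanishing_loop_def h intro!: continuous_intros)
    show "nonvanishing_loop (polar_gradient m h)"
      unfolding nonvanishing_loop_def using Nil(2) continuous_polar_gradient polar_gradient_periodic
      by auto
    show "0 < Re (1 * cnj (complex_of_real (eval2 h (pt t))) * polar_gradient m h t)" for t
    proof -
      have "Re (1 * cnj (complex_of_real (eval2 h (pt t))) * polar_gradient m h t) = m * (eval2 h (pt t))\<^sup>2"
        by (simp add: polar_gradient_def power2_eq_square)
      then show ?thesis using m h[of t] by simp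
    qed
  qed
  then show ?case by simp
next
  case (Cons l ls)
  obtain a b where ab: "a \<noteq> 0 \<or> b \<noteq> 0" "l = linear_form a b" using Cons.prems(1) by auto
  have "polar_gradient m (prod_list ls * h) t \<noteq> 0" for t
    using Cons.prems(2)[of t] m by (auto simp: polar_gradient_def rot_mult complex_eq_iff mult.assoc)
  then have "turns (polar_gradient m (prod_list ls * h)) (- int (length ls))"
    using Cons.IH Cons.prems(1) by simp
  from turns_polar_gradient_times_linear[OF m ab(1) this] Cons.prems(2)
  have "turns (polar_gradient m (prod_list (l # ls) * h)) (- int (length ls) - 1)"
    by (simp add: ab(2) mult.assoc)
  moreover have "- int (length ls) - 1 = - int (length (l # ls))" by simp
  ultimately show ?case by (simp only:)
qed

definition gradient :: "bipoly \<Rightarrow> real \<times> real \<Rightarrow> complex" where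
  "gradient P p = Complex (eval2 (dx P) p) (eval2 (dy P) p)"

lemma gradient_polar:
  assumes "homogeneous d P"
  shows "gradient P (pt t) = cis t * polar_gradient (real d) P t"
proof -
  have "real d * eval2 P (pt t) = cos t * eval2 (dx P) (pt t) + sin t * eval2 (dy P) (pt t)"
    using arg_cong[OF Euler_identity[OF assms], of "\<lambda>Q. eval2 Q (pt t)"] by (simp add: pt_def)
  moreover have "(cos t)\<^sup>2 + (sin t)\<^sup>2 = 1" by simp
  ultimately have
    "eval2 (dx P) (pt t) = cos t * (real d * eval2 P (pt t))
      - sin t * (cos t * eval2 (dy P) (pt t) - sin t * eval2 (dx P) (pt t))"
    "eval2 (dy P) (pt t) = cos t * (cos t * eval2 (dy P) (pt t) - sin t * eval2 (dx P) (pt t))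
      + sin t * (real d * eval2 P (pt t))"
    by algebra+
  then show ?thesis
    by (intro complex_eqI) (simp_all add: gradient_def polar_gradient_def rot_def pt_def)
qed

section \<open>The direction conjugate to the level curves\<close>

text \<open>
  The covector \<open>Hess f (\<cdot>, (\<nabla>f)\<^sup>\<bottom>)\<close>. Its kernel is the direction conjugate to the level curve with
  respect to the Hessian.
\<close>

definition conj_x :: "bipoly \<Rightarrow> bipoly" where
  "conj_x f = dx (dx f) * dy f - dx (dy f) * dx f"

definition conj_y :: "bipoly \<Rightarrow> bipoly" where
  "conj_y f = dx (dy f) * dy f - dy (dy f) * dx f"

definition conj_radial :: "bipoly \<Rightarrow> bipoly" where
  "conj_radial f = varx * conj_x f + vary * conj_y f"

definition conj_angular :: "bipoly \<Rightarrow> bipoly" where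
  "conj_angular f = varx * conj_y f - vary * conj_x f"

lemma degree_le_dx2: "degree_le d P \<Longrightarrow> degree_le (d - 2) (dx (dx P))"
  and degree_le_dxy: "degree_le d P \<Longrightarrow> degree_le (d - 2) (dx (dy P))"
  and degree_le_dy2: "degree_le d P \<Longrightarrow> degree_le (d - 2) (dy (dy P))"
  using degree_le_dx[of "d - 1"] degree_le_dy[of "d - 1"] degree_le_dx[of d P] degree_le_dy[of d P] by force+

lemma degree_le_multI: "degree_le d P \<Longrightarrow> degree_le e Q \<Longrightarrow> d + e \<le> k \<Longrightarrow> degree_le k (P * Q)"
  using degree_le_mult degree_le_mono by blast

text \<open>
  By Euler's identity the top forms of the two factors of each product are proportional, so the terms of
  degree \<open>2 k + 1\<close> in which only \<open>g\<close> occurs cancel. The leading term comes from the interaction of \<open>g\<close>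
  with \<open>h\<close>, and this is how the form \<open>\<nabla>h \<cdot> (\<nabla>g)\<^sup>\<bottom>\<close> enters.
\<close>

lemma conj_radial_leading:
  assumes g: "homogeneous (Suc (Suc k)) g" and h: "homogeneous (Suc k) h" and e: "degree_le (int k) e"
  shows "degree_le (2 * int k) (conj_radial (g + h + e) + grad_dot_perp_grad h g)"
proof -
  define ex ey where "ex = varx * dx (dx e) + vary * dx (dy e)" and "ey = varx * dx (dy e) + vary * dy (dy e)"
  let ?f = "g + h + e"
  have E: "varx * dx (dx g) + vary * dx (dy g) = (1 + of_nat k) * dx g"
    "varx * dx (dy g) + vary * dy (dy g) = (1 + of_nat k) * dy g"
    "varx * dx (dx h) + vary * dx (dy h) = of_nat k * dx h"
    "varx * dx (dy h) + vary * dy (dy h) = of_nat k * dy h"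
    using Euler_identity[OF homogeneous_dx[OF g]] Euler_identity[OF homogeneous_dy[OF g]]
      Euler_identity[OF homogeneous_dx[OF h]] Euler_identity[OF homogeneous_dy[OF h]]
    by (simp_all add: dx_dy)
  have "conj_radial ?f = (varx * dx (dx ?f) + vary * dx (dy ?f)) * dy ?f - (varx * dx (dy ?f) + vary * dy (dy ?f)) * dx ?f"
    unfolding conj_radial_def conj_x_def conj_y_def by (simp only: algebra_simps)
  also have "varx * dx (dx ?f) + vary * dx (dy ?f) = (1 + of_nat k) * dx g + of_nat k * dx h + ex"
    unfolding E[symmetric] ex_def by (simp add: algebra_simps)
  also have "varx * dx (dy ?f) + vary * dy (dy ?f) = (1 + of_nat k) * dy g + of_nat k * dy h + ey"
    unfolding E[symmetric] ey_def by (simp add: algebra_simps)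
  finally have "conj_radial ?f + grad_dot_perp_grad h g
    = (1 + of_nat k) * (dx g * dy e - dy g * dx e) + of_nat k * (dx h * dy e - dy h * dx e)
      + ex * dy ?f - ey * dx ?f"
    unfolding grad_dot_perp_grad_def dx_add dy_add by algebra
  moreover have "degree_le (2 * int k) \<dots>"
  proof -
    have dg: "degree_le (int k + 1) (dx g)" "degree_le (int k + 1) (dy g)"
      using homogeneous_imp_degree_le[OF homogeneous_dx[OF g]] homogeneous_imp_degree_le[OF homogeneous_dy[OF g]] by simp_all
    have dh: "degree_le (int k) (dx h)" "degree_le (int k) (dy h)"
      using homogeneous_imp_degree_le[OF homogeneous_dx[OF h]] homogeneous_imp_degree_le[OF homogeneous_dy[OF h]] by simp_all
    note de = degree_le_dx[OF e] degree_le_dy[OF e]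
    have "degree_le (int k + 2) g" "degree_le (int k + 2) h" "degree_le (int k + 2) e"
      using homogeneous_imp_degree_le[OF g] homogeneous_imp_degree_le[OF h] degree_le_mono[OF e] by simp_all
    then have f: "degree_le (int k + 2) ?f" by (intro degree_le_add)
    have dfx: "degree_le (int k + 1) (dx ?f)" by (rule degree_le_mono[OF degree_le_dx[OF f]]) simp
    have dfy: "degree_le (int k + 1) (dy ?f)" by (rule degree_le_mono[OF degree_le_dy[OF f]]) simp
    have dex: "degree_le (int k - 1) ex" unfolding ex_def
      by (intro degree_le_add degree_le_multI[OF degree_le_vars(1) degree_le_dx2[OF e]]
          degree_le_multI[OF degree_le_vars(2) degree_le_dxy[OF e]]) simp_all
    have dey: "degree_le (int k - 1) ey" unfolding ey_def
      by (intro degree_le_add degree_le_multI[OF degree_le_vars(1) degree_le_dxy[OF e]]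
          degree_le_multI[OF degree_le_vars(2) degree_le_dy2[OF e]]) simp_all
    have c: "degree_le 0 (1 + of_nat k)" "degree_le 0 (of_nat k)"
      using degree_le_of_nat[of "Suc k"] degree_le_of_nat[of k] by simp_all
    have d1: "degree_le (2 * int k) (dx g * dy e - dy g * dx e)"
      by (intro degree_le_diff degree_le_multI[OF dg(1) de(2)] degree_le_multI[OF dg(2) de(1)]) simp_all
    have d2: "degree_le (2 * int k) (dx h * dy e - dy h * dx e)"
      by (intro degree_le_diff degree_le_multI[OF dh(1) de(2)] degree_le_multI[OF dh(2) de(1)]) simp_all
    show ?thesis
      by (intro degree_le_diff degree_le_add degree_le_multI[OF c(1) d1] degree_le_multI[OF c(2) d2]
          degree_le_multI[OF dex dfy] degree_le_multI[OF dey dfx]) simp_all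
  qed
  ultimately show ?thesis by simp
qed

text \<open>
  For \<open>d = 0\<close> and on the unit circle this is the identity \<open>(k + 1) Hess g (e, (\<nabla>g)\<^sup>\<bottom>) = - \<bar>Hess g\<bar>\<close> for the angular unit vector
  \<open>e\<close>, again by Euler's identity for the partial derivatives of \<open>g\<close>.
\<close>

lemma conj_angular_leading:
  assumes g: "homogeneous (Suc (Suc k)) g" and d: "degree_le (int k + 1) d"
  shows "degree_le (2 * int k + 1)
    (of_nat (Suc k) * conj_angular (g + d) + (varx\<^sup>2 + vary\<^sup>2) * hess g)"
proof -
  have E: "varx * dx (dx g) + vary * dx (dy g) = of_nat (Suc k) * dx g"
    "varx * dx (dy g) + vary * dy (dy g) = of_nat (Suc k) * dy g"
    using Euler_identity[OF homogeneous_dx[OF g]] Euler_identity[OF homogeneous_dy[OF g]]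
    by (simp_all add: dx_dy)
  define rx ry where "rx = dx (dx g) * dy d + dx (dx d) * dy (g + d) - dx (dy g) * dx d - dx (dy d) * dx (g + d)"
    and "ry = dx (dy g) * dy d + dx (dy d) * dy (g + d) - dy (dy g) * dx d - dy (dy d) * dx (g + d)"
  have "of_nat (Suc k) * conj_angular g = - (varx\<^sup>2 + vary\<^sup>2) * hess g"
  proof -
    have "of_nat (Suc k) * conj_angular g
      = varx * (dx (dy g) * (of_nat (Suc k) * dy g) - dy (dy g) * (of_nat (Suc k) * dx g))
        - vary * (dx (dx g) * (of_nat (Suc k) * dy g) - dx (dy g) * (of_nat (Suc k) * dx g))"
      unfolding conj_angular_def conj_x_def conj_y_def by algebra
    also have "\<dots> = - (varx\<^sup>2 + vary\<^sup>2) * hess g"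
      unfolding E[symmetric] hess_def by algebra
    finally show ?thesis .
  qed
  moreover have "conj_angular (g + d) = conj_angular g + (varx * ry - vary * rx)"
    unfolding conj_angular_def conj_x_def conj_y_def rx_def ry_def dx_add dy_add by algebra
  ultimately have eq: "of_nat (Suc k) * conj_angular (g + d) + (varx\<^sup>2 + vary\<^sup>2) * hess g
      = of_nat (Suc k) * (varx * ry - vary * rx)" by (simp only: distrib_left)
  have dg: "degree_le (int k + 2) g" using homogeneous_imp_degree_le[OF g] by simp
  have "degree_le (int k + 2) (g + d)" by (intro degree_le_add dg degree_le_mono[OF d]) simp
  note dgd = degree_le_dx[OF this] degree_le_dy[OF this]
  note gg = degree_le_dx2[OF dg] degree_le_dxy[OF dg] degree_le_dy2[OF dg]
  note dd = degree_le_dx2[OF d] degree_le_dxy[OF d] degree_le_dy2[OF d] degree_le_dx[OF d] degree_le_dy[OF d]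
  have rx: "degree_le (2 * int k) rx"
    unfolding rx_def
    by (intro degree_le_diff degree_le_add degree_le_multI[OF gg(1) dd(5)] degree_le_multI[OF dd(1) dgd(2)]
      degree_le_multI[OF gg(2) dd(4)] degree_le_multI[OF dd(2) dgd(1)]) simp_all
  have ry: "degree_le (2 * int k) ry"
    unfolding ry_def
    by (intro degree_le_diff degree_le_add degree_le_multI[OF gg(2) dd(5)] degree_le_multI[OF dd(2) dgd(2)]
      degree_le_multI[OF gg(3) dd(4)] degree_le_multI[OF dd(3) dgd(1)]) simp_all
  have "degree_le (2 * int k + 1) (varx * ry - vary * rx)"
    by (intro degree_le_diff degree_le_multI[OF degree_le_vars(1) ry]
      degree_le_multI[OF degree_le_vars(2) rx]) simp_all
  then show ?thesis unfolding eq by (rule degree_le_multI[OF degree_le_of_nat]) simp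
qed

section \<open>Behaviour at infinity\<close>

definition on_circle :: "real \<Rightarrow> real \<Rightarrow> real \<times> real" where
  "on_circle r t = (r * cos t, r * sin t)"

lemma on_circle_periodic [simp]: "on_circle r (t + 2 * pi) = on_circle r t"
  by (simp add: on_circle_def)

lemma continuous_on_circle [continuous_intros]: "continuous_on S (on_circle r)"
  unfolding on_circle_def by (intro continuous_intros)

lemma Re_Im_circle0: "(Re (circle 0 r t), Im (circle 0 r t)) = on_circle r t"
  by (simp add: circle_def on_circle_def)

lemma eval2_on_circle:
  "homogeneous d P \<Longrightarrow> eval2 P (on_circle r t) = r ^ d * eval2 P (pt t)"
  unfolding on_circle_def pt_def by (rule eval2_homogeneous)

lemma bound_on_circle:
  assumes "degree_le (int d) P"
  obtains C where "C \<ge> 0" "\<And>r t. r \<ge> 1 \<Longrightarrow> \<bar>eval2 P (on_circle r t)\<bar> \<le> C * r ^ d"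
proof -
  obtain C where C: "C \<ge> 0" "\<And>x y r. r \<ge> 1 \<Longrightarrow> \<bar>x\<bar> \<le> r \<Longrightarrow> \<bar>y\<bar> \<le> r \<Longrightarrow> \<bar>eval2 P (x, y)\<bar> \<le> C * r ^ d"
    using degree_le_bound[OF assms] by blast
  have "\<bar>eval2 P (on_circle r t)\<bar> \<le> C * r ^ d" if "r \<ge> 1" for r t
    unfolding on_circle_def
  proof (rule C(2)[OF that])
    show "\<bar>r * cos t\<bar> \<le> r" "\<bar>r * sin t\<bar> \<le> r"
      using that mult_left_mono[OF abs_cos_le_one[of t], of r] mult_left_mono[OF abs_sin_le_one[of t], of r]
      by (auto simp: abs_mult)
  qed
  then show ?thesis using that C(1) by blast
qed

text \<open>
  The remainder has a gradient of lower order, and the gradient of \<open>g\<close> has no zero on the unit circle.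
\<close>

lemma turns_gradient_at_infinity:
  assumes g: "homogeneous (Suc (Suc k)) g" and d: "degree_le (int k + 1) d"
    and \<phi>: "turns (\<lambda>t. gradient g (pt t)) j"
  obtains \<delta> R where "\<delta> > 0" "R \<ge> 1" "\<And>r. r \<ge> R \<Longrightarrow> turns (\<lambda>t. gradient (g + d) (on_circle r t)) j"
    "\<And>r t. r \<ge> R \<Longrightarrow> \<delta> * r ^ Suc k \<le> cmod (gradient (g + d) (on_circle r t))"
proof -
  have "degree_le (int k) (dx d)" using degree_le_dx[OF d] by simp
  then obtain C1 where C1: "\<And>r t. r \<ge> 1 \<Longrightarrow> \<bar>eval2 (dx d) (on_circle r t)\<bar> \<le> C1 * r ^ k"
    using bound_on_circle by blast
  have "degree_le (int k) (dy d)" using degree_le_dy[OF d] by simp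
  then obtain C2 where C2: "\<And>r t. r \<ge> 1 \<Longrightarrow> \<bar>eval2 (dy d) (on_circle r t)\<bar> \<le> C2 * r ^ k"
    using bound_on_circle by blast
  have hom: "homogeneous (Suc k) (dx g)" "homogeneous (Suc k) (dy g)"
    using homogeneous_dx[OF g] homogeneous_dy[OF g] by simp_all
  show ?thesis
  proof (rule turns_leading_term[OF \<phi>, of "\<lambda>r t. gradient (g + d) (on_circle r t)" k "C1 + C2"])
    show "continuous_on UNIV (\<lambda>t. gradient (g + d) (on_circle r t))" for r
      unfolding gradient_def by (intro continuous_on_Complex continuous_intros)
    fix r t :: real assume r: "r \<ge> 1"
    let ?z = "gradient (g + d) (on_circle r t) - of_real (r ^ Suc k) * gradient g (pt t)"
    have "?z = Complex (eval2 (dx d) (on_circle r t)) (eval2 (dy d) (on_circle r t))"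
      by (simp add: gradient_def complex_eq_iff eval2_on_circle[OF hom(1)] eval2_on_circle[OF hom(2)] del: power_Suc)
    then show "cmod ?z \<le> (C1 + C2) * r ^ k"
      using cmod_le[of ?z] C1[OF r, of t] C2[OF r, of t] by (simp add: distrib_right)
  qed (use that in \<open>simp_all del: power_Suc\<close>)
qed

lemma eval2_hess_scale:
  assumes "homogeneous (Suc (Suc k)) g"
  shows "eval2 (hess g) (s * x, s * y) = s ^ (2 * k) * eval2 (hess g) (x, y)"
proof -
  have hom: "homogeneous k (dx (dx g))" "homogeneous k (dx (dy g))" "homogeneous k (dy (dy g))"
    using homogeneous_dx[OF homogeneous_dx[OF assms]] homogeneous_dx[OF homogeneous_dy[OF assms]]
      homogeneous_dy[OF homogeneous_dy[OF assms]] by simp_all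
  have s: "s ^ (2 * k) = s ^ k * s ^ k" by (simp only: mult_2 power_add)
  show ?thesis
    unfolding hess_def s eval2_simps eval2_homogeneous[OF hom(1)] eval2_homogeneous[OF hom(2)]
      eval2_homogeneous[OF hom(3)]
    by (simp add: power2_eq_square algebra_simps)
qed

lemma eval2_grad_dot_perp_grad_scale:
  assumes "homogeneous (Suc (Suc k)) g" "homogeneous (Suc k) h"
  shows "eval2 (grad_dot_perp_grad h g) (s * x, s * y) = s ^ Suc (2 * k) * eval2 (grad_dot_perp_grad h g) (x, y)"
proof -
  have hom: "homogeneous (Suc k) (dx g)" "homogeneous (Suc k) (dy g)" "homogeneous k (dx h)" "homogeneous k (dy h)"
    using homogeneous_dx[OF assms(1)] homogeneous_dy[OF assms(1)]
      homogeneous_dx[OF assms(2)] homogeneous_dy[OF assms(2)] by simp_all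
  have s: "s ^ Suc (2 * k) = s * s ^ k * s ^ k" by (simp add: mult_2 power_add)
  show ?thesis
    unfolding grad_dot_perp_grad_def s eval2_simps eval2_homogeneous[OF hom(1)] eval2_homogeneous[OF hom(2)]
      eval2_homogeneous[OF hom(3)] eval2_homogeneous[OF hom(4)]
    by (simp add: algebra_simps)
qed

definition conj_direction :: "bipoly \<Rightarrow> real \<times> real \<Rightarrow> complex" where
  "conj_direction f p = Complex (eval2 (conj_x f) p) (eval2 (conj_y f) p)"

lemma conj_direction_polar:
  "cis t * Complex (eval2 (conj_radial f) (on_circle r t)) (eval2 (conj_angular f) (on_circle r t))
    = of_real r * conj_direction f (on_circle r t)"
proof -
  have trig: "(cos t)\<^sup>2 + (sin t)\<^sup>2 = 1" by simp
  show ?thesis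
  proof (rule complex_eqI)
    let ?u = "eval2 (conj_x f) (on_circle r t)" and ?v = "eval2 (conj_y f) (on_circle r t)"
    have "cos t * (r * cos t * ?u + r * sin t * ?v) - sin t * (r * cos t * ?v - r * sin t * ?u) = r * ?u"
      "cos t * (r * cos t * ?v - r * sin t * ?u) + sin t * (r * cos t * ?u + r * sin t * ?v) = r * ?v"
      using trig by algebra+
    then show "Re (cis t * Complex (eval2 (conj_radial f) (on_circle r t)) (eval2 (conj_angular f) (on_circle r t)))
      = Re (of_real r * conj_direction f (on_circle r t))"
      "Im (cis t * Complex (eval2 (conj_radial f) (on_circle r t)) (eval2 (conj_angular f) (on_circle r t)))
      = Im (of_real r * conj_direction f (on_circle r t))"
      by (simp_all add: conj_radial_def conj_angular_def conj_direction_def,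
          simp_all add: on_circle_def)
  qed
qed

text \<open>
  In the polar frame, the radial component is of order \<open>2 k + 1\<close> and the angular one of order \<open>2 k + 2\<close>
  in \<open>r\<close> (after multiplication by \<open>r\<close>). Dividing the latter by \<open>r\<close>, which does not affect the turning number, puts the two on
  the same scale. The limit path has components \<open>- J\<close> and \<open>- H / (k + 1)\<close>, which do not vanish
  simultaneously. The degrees of \<open>J\<close> and \<open>H\<close> are odd and even, so by its symmetry under a half turn the
  path does not turn in total; what remains is the one turn of the polar frame.
\<close>

lemma turns_conj_direction_at_infinity:
  assumes g: "homogeneous (Suc (Suc k)) g" and h: "homogeneous (Suc k) h" and e: "degree_le (int k) e"
    and nz: "\<And>t. eval2 (hess g) (pt t) \<noteq> 0 \<or> eval2 (grad_dot_perp_grad h g) (pt t) \<noteq> 0"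
  obtains \<delta> R where "\<delta> > 0" "R \<ge> 1" "\<And>r. r \<ge> R \<Longrightarrow> turns (\<lambda>t. conj_direction (g + h + e) (on_circle r t)) 1"
    "\<And>r t. r \<ge> R \<Longrightarrow> \<delta> * r ^ (2 * k) \<le> cmod (conj_direction (g + h + e) (on_circle r t))"
proof -
  let ?f = "g + h + e"
  define J where "J t = eval2 (grad_dot_perp_grad h g) (pt t)" for t
  define H where "H t = eval2 (hess g) (pt t)" for t
  define P Q where "P r t = eval2 (conj_radial ?f) (on_circle r t)" and "Q r t = eval2 (conj_angular ?f) (on_circle r t)" for r t
  define \<phi> where "\<phi> t = Complex (- J t) (- (H t / real (Suc k)))" for t
  have "pt (t + pi) = (-1 * cos t, -1 * sin t)" for t by (simp add: pt_def)
  then have half: "J (t + pi) = - J t" "H (t + pi) = H t" for t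
    unfolding J_def H_def
    using eval2_grad_dot_perp_grad_scale[OF g h, of "-1" "cos t" "sin t"] eval2_hess_scale[OF g, of "-1" "cos t" "sin t"]
    by (simp_all add: pt_def)
  have \<phi>: "turns \<phi> 0"
  proof (rule turns_reflected_half_turn)
    show "nonvanishing_loop \<phi>"
      unfolding nonvanishing_loop_def \<phi>_def
      using nz by (auto simp: J_def H_def complex_eq_iff intro!: continuous_on_Complex continuous_intros)
    show "\<phi> (t + pi) = - cnj (\<phi> t)" for t by (simp add: \<phi>_def half complex_eq_iff)
  qed
  define R1 where "R1 = conj_radial ?f + grad_dot_perp_grad h g"
  define R2 where "R2 = of_nat (Suc k) * conj_angular ?f + (varx\<^sup>2 + vary\<^sup>2) * hess g"
  have "degree_le (int (2 * k)) R1" unfolding R1_def using conj_radial_leading[OF g h e] by simp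
  then obtain C1 where C1: "C1 \<ge> 0" "\<And>r t. r \<ge> 1 \<Longrightarrow> \<bar>eval2 R1 (on_circle r t)\<bar> \<le> C1 * r ^ (2 * k)"
    using bound_on_circle by blast
  have "degree_le (int k + 1) (h + e)"
    using homogeneous_imp_degree_le[OF h] degree_le_mono[OF e] by (intro degree_le_add) simp_all
  moreover have "int (Suc (2 * k)) = 2 * int k + 1" by simp
  ultimately have "degree_le (int (Suc (2 * k))) R2"
    unfolding R2_def using conj_angular_leading[OF g] by (simp only: add.assoc)
  then obtain C2 where C2: "C2 \<ge> 0" "\<And>r t. r \<ge> 1 \<Longrightarrow> \<bar>eval2 R2 (on_circle r t)\<bar> \<le> C2 * r ^ Suc (2 * k)"
    using bound_on_circle by blast
  have P: "P r t = - (r ^ Suc (2 * k) * J t) + eval2 R1 (on_circle r t)" for r t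
  proof -
    have "eval2 (grad_dot_perp_grad h g) (on_circle r t) = r ^ Suc (2 * k) * J t"
      unfolding on_circle_def J_def pt_def by (rule eval2_grad_dot_perp_grad_scale[OF g h])
    then show ?thesis by (simp add: P_def R1_def del: power_Suc)
  qed
  have Q: "real (Suc k) * Q r t = - (r\<^sup>2 * (r ^ (2 * k) * H t)) + eval2 R2 (on_circle r t)" for r t
  proof -
    have "eval2 (hess g) (on_circle r t) = r ^ (2 * k) * H t"
      unfolding on_circle_def H_def pt_def by (rule eval2_hess_scale[OF g])
    moreover have "(r * cos t)\<^sup>2 + (r * sin t)\<^sup>2 = r\<^sup>2"
      by (simp add: power_mult_distrib flip: distrib_left)
    ultimately have "eval2 ((varx\<^sup>2 + vary\<^sup>2) * hess g) (on_circle r t) = r\<^sup>2 * (r ^ (2 * k) * H t)"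
      by (simp add: on_circle_def)
    then show ?thesis unfolding R2_def eval2_simps(3) eval2_simps(6)[of "of_nat _"] eval2_simps(8) Q_def by simp
  qed
  obtain \<delta> R where \<delta>: "\<delta> > 0" "R \<ge> 1" "\<And>r. r \<ge> R \<Longrightarrow> turns (\<lambda>t. Complex (P r t) (Q r t / r)) 0"
    "\<And>r t. r \<ge> R \<Longrightarrow> \<delta> * r ^ Suc (2 * k) \<le> cmod (Complex (P r t) (Q r t / r))"
  proof (rule turns_leading_term[OF \<phi>, of "\<lambda>r t. Complex (P r t) (Q r t / r)" "2 * k" "C1 + C2"])
    show "continuous_on UNIV (\<lambda>t. Complex (P r t) (Q r t / r))" for r
      unfolding P_def Q_def divide_inverse by (intro continuous_on_Complex continuous_intros)
    fix r t :: real assume r: "r \<ge> 1"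
    let ?z = "Complex (P r t) (Q r t / r) - of_real (r ^ Suc (2 * k)) * \<phi> t"
    have "Re ?z = eval2 R1 (on_circle r t)" by (simp add: P \<phi>_def del: power_Suc)
    moreover have "Im ?z = eval2 R2 (on_circle r t) / (real (Suc k) * r)"
    proof -
      have "real (Suc k) * r * Im ?z = real (Suc k) * Q r t + r\<^sup>2 * (r ^ (2 * k) * H t)"
        using r by (simp add: \<phi>_def field_simps power2_eq_square del: of_nat_Suc)
      then have "real (Suc k) * r * Im ?z = eval2 R2 (on_circle r t)" unfolding Q by simp
      then show ?thesis using r by (simp add: field_simps del: of_nat_Suc)
    qed
    moreover have "\<bar>eval2 R2 (on_circle r t) / (real (Suc k) * r)\<bar> \<le> C2 * r ^ (2 * k)"
    proof -
      have "\<bar>eval2 R2 (on_circle r t)\<bar> \<le> C2 * r ^ (2 * k) * r" using C2(2)[OF r, of t] by (simp add: mult_ac)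
      also have "\<dots> \<le> C2 * r ^ (2 * k) * (real (Suc k) * r)"
        using C2(1) r by (intro mult_left_mono) auto
      finally show ?thesis using r by (simp add: abs_mult divide_le_eq del: of_nat_Suc)
    qed
    ultimately show "cmod ?z \<le> (C1 + C2) * r ^ (2 * k)"
      using cmod_le[of ?z] C1(2)[OF r, of t] by (simp only: distrib_right)
  next
    show "Complex (P r (t + 2 * pi)) (Q r (t + 2 * pi) / r) = Complex (P r t) (Q r t / r)" for r t
      by (simp add: P_def Q_def)
  qed (rule that)
  have loop: "turns (\<lambda>t. Complex (P r t) (Q r t)) 0" if r: "r \<ge> R" for r
  proof (rule turns_transfer[OF \<delta>(3)[OF r], where c = 1])
    have r1: "r \<ge> 1" using r \<delta>(2) by simp
    have nz: "P r t \<noteq> 0 \<or> Q r t \<noteq> 0" for t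
      using turns_imp_loop[OF \<delta>(3)[OF r]] r1 unfolding nonvanishing_loop_def
      by (metis complex.sel complex_eq_iff divide_eq_0_iff zero_complex.sel)
    then show "nonvanishing_loop (\<lambda>t. Complex (P r t) (Q r t))"
      unfolding nonvanishing_loop_def
      by (auto simp: P_def Q_def complex_eq_iff intro!: continuous_on_Complex continuous_intros)
    fix t
    have "Re (1 * cnj (Complex (P r t) (Q r t / r)) * Complex (P r t) (Q r t)) = (P r t)\<^sup>2 + (Q r t)\<^sup>2 / r"
      by (simp add: power2_eq_square)
    also have "\<dots> > 0"
    proof (cases "P r t = 0")
      case True
      then show ?thesis using nz[of t] r1 by simp
    next
      case False
      then show ?thesis using r1 by (intro add_pos_nonneg) auto
    qed
    finally show "0 < Re (1 * cnj (Complex (P r t) (Q r t / r)) * Complex (P r t) (Q r t))" .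
  qed
  have dir: "conj_direction ?f (on_circle r t) = of_real (1 / r) * (cis t * Complex (P r t) (Q r t))"
    if "r \<ge> 1" for r t
    unfolding P_def Q_def conj_direction_polar using that by simp
  show ?thesis
  proof (rule that[OF \<delta>(1,2)])
    fix r :: real assume r: "r \<ge> R"
    then have r1: "r \<ge> 1" using \<delta>(2) by simp
    have "turns (\<lambda>t. of_real (1 / r) * (cis t * Complex (P r t) (Q r t))) (0 + (1 + 0))"
      using r1 by (intro turns_mult turns_const turns_cis loop[OF r]) simp
    then show "turns (\<lambda>t. conj_direction ?f (on_circle r t)) 1" by (simp add: dir[OF r1])
    fix t
    have "\<delta> * r ^ Suc (2 * k) \<le> cmod (Complex (P r t) (Q r t / r))" by (rule \<delta>(4)[OF r])
    also have "\<dots> \<le> cmod (Complex (P r t) (Q r t))"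
    proof -
      have "\<bar>Q r t / r\<bar> \<le> \<bar>Q r t\<bar>"
        using r1 mult_left_mono[OF r1, of "\<bar>Q r t\<bar>"] by (simp add: divide_le_eq)
      then have "(Q r t / r)\<^sup>2 \<le> (Q r t)\<^sup>2" by (simp only: abs_le_square_iff)
      then show ?thesis by (simp add: cmod_def)
    qed
    finally have "\<delta> * r ^ (2 * k) * r \<le> cmod (Complex (P r t) (Q r t))" by (simp add: mult_ac)
    then show "\<delta> * r ^ (2 * k) \<le> cmod (conj_direction ?f (on_circle r t))"
      using r1 by (simp add: dir[OF r1] norm_mult norm_divide pos_le_divide_eq)
  qed
qed

text \<open>
  The key factorization. To leading order the form of the principal directions is the product of the
  differential of \<open>f\<close> and the covector \<open>Hess f (\<cdot>, (\<nabla>f)\<^sup>\<bottom>)\<close>, that is, the two families of lines of curvature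
  approach the level curves and their conjugate directions; as a complex function the product of forms
  becomes a product of complex numbers.
\<close>

lemma direction_field_eq:
  assumes "(Re z, Im z) = p"
  shows "direction_field f z = - (gradient f p * conj_direction f p)
    + Complex (2 * eval2 (dx (dy f)) p) (eval2 (dy (dy f)) p - eval2 (dx (dx f)) p)"
proof -
  note defs = p_x_def p_y_def p_xx_def p_xy_def p_yy_def
  show ?thesis
    unfolding direction_field_def pencil.a_def pencil.b_def pencil.c_def
    unfolding form_E_def form_F_def form_G_def
    unfolding defs assms gradient_def conj_direction_def conj_x_def conj_y_def
    by (simp add: complex_eq_iff power2_eq_square algebra_simps)
qed

text \<open>
  The product in the factorization grows at least like \<open>r ^ (3 k + 1)\<close>, and the correction, which is linear in the
  second derivatives, at most like \<open>r ^ k\<close>.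
\<close>

lemma turns_direction_field_at_infinity:
  assumes g: "homogeneous (Suc (Suc k)) g" and h: "homogeneous (Suc k) h" and e: "degree_le (int k) e"
    and nz: "\<And>t. eval2 (hess g) (pt t) \<noteq> 0 \<or> eval2 (grad_dot_perp_grad h g) (pt t) \<noteq> 0"
    and j: "turns (\<lambda>t. gradient g (pt t)) j"
  obtains R where "R > 0" "\<And>r. r \<ge> R \<Longrightarrow> turns (\<lambda>t. direction_field (g + h + e) (circle 0 r t)) (j + 1)"
proof -
  let ?f = "g + h + e"
  have he: "degree_le (int k + 1) (h + e)"
    using homogeneous_imp_degree_le[OF h] degree_le_mono[OF e] by (intro degree_le_add) simp_all
  obtain \<delta> R where \<delta>: "\<delta> > 0" "R \<ge> 1" "\<And>r. r \<ge> R \<Longrightarrow> turns (\<lambda>t. gradient ?f (on_circle r t)) j"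
    "\<And>r t. r \<ge> R \<Longrightarrow> \<delta> * r ^ Suc k \<le> cmod (gradient ?f (on_circle r t))"
    using turns_gradient_at_infinity[OF g he j] unfolding add.assoc by blast
  obtain \<epsilon> T where \<epsilon>: "\<epsilon> > 0" "T \<ge> 1" "\<And>r. r \<ge> T \<Longrightarrow> turns (\<lambda>t. conj_direction ?f (on_circle r t)) 1"
    "\<And>r t. r \<ge> T \<Longrightarrow> \<epsilon> * r ^ (2 * k) \<le> cmod (conj_direction ?f (on_circle r t))"
    using turns_conj_direction_at_infinity[OF g h e nz] by blast
  have "degree_le (int k + 2) g" "degree_le (int k + 2) (h + e)"
    using homogeneous_imp_degree_le[OF g] degree_le_mono[OF he] by simp_all
  then have "degree_le (int k + 2) ?f" unfolding add.assoc by (rule degree_le_add)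
  from degree_le_dx2[OF this] degree_le_dxy[OF this] degree_le_dy2[OF this]
  have 2: "degree_le (int k) (dx (dx ?f))" "degree_le (int k) (dx (dy ?f))" "degree_le (int k) (dy (dy ?f))"
    by (simp_all only: add_diff_cancel_right')
  define V where "V r t = Complex (2 * eval2 (dx (dy ?f)) (on_circle r t))
      (eval2 (dy (dy ?f)) (on_circle r t) - eval2 (dx (dx ?f)) (on_circle r t))" for r t
  obtain C1 where C1: "\<And>r t. r \<ge> 1 \<Longrightarrow> \<bar>eval2 (dx (dx ?f)) (on_circle r t)\<bar> \<le> C1 * r ^ k"
    by (rule bound_on_circle[OF 2(1)]) (rule that)
  obtain C2 where C2: "\<And>r t. r \<ge> 1 \<Longrightarrow> \<bar>eval2 (dx (dy ?f)) (on_circle r t)\<bar> \<le> C2 * r ^ k"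
    by (rule bound_on_circle[OF 2(2)]) (rule that)
  obtain C3 where C3: "\<And>r t. r \<ge> 1 \<Longrightarrow> \<bar>eval2 (dy (dy ?f)) (on_circle r t)\<bar> \<le> C3 * r ^ k"
    by (rule bound_on_circle[OF 2(3)]) (rule that)
  define C where "C = C1 + 2 * C2 + C3"
  have V: "cmod (V r t) \<le> C * r ^ k" if "r \<ge> 1" for r t
    using cmod_le[of "V r t"] C1[OF that, of t] C2[OF that, of t] C3[OF that, of t]
    by (simp add: V_def C_def algebra_simps)
  \<comment> \<open>The last entry makes \<open>C r ^ k\<close> less than \<open>\<delta> \<epsilon> r ^ (k + 1)\<close>.\<close>
  define S where "S = max (max R T) (C / (\<delta> * \<epsilon>) + 1)"
  show ?thesis
  proof
    show "S > 0" using \<delta>(2) by (auto simp: S_def)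
    fix r :: real assume "r \<ge> S"
    then have r: "r \<ge> R" "r \<ge> T" "r \<ge> 1" "r > C / (\<delta> * \<epsilon>)" using \<delta>(2) by (auto simp: S_def)
    let ?M = "\<lambda>t. (- 1) * (gradient ?f (on_circle r t) * conj_direction ?f (on_circle r t))"
    have "turns ?M (0 + (j + 1))"
      by (intro turns_mult turns_const \<delta>(3)[OF r(1)] \<epsilon>(3)[OF r(2)]) simp
    then have M: "turns ?M (j + 1)" by simp
    have W: "direction_field ?f (circle 0 r t) = ?M t + V r t" for t
      by (simp add: direction_field_eq[OF Re_Im_circle0] V_def)
    have "cmod (V r t) < cmod (?M t)" for t
    proof -
      have "cmod (V r t) \<le> C * r ^ k" by (rule V[OF r(3)])
      also have "\<dots> < (\<delta> * \<epsilon> * r) * r ^ k"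
        using r \<delta>(1) \<epsilon>(1) by (intro mult_strict_right_mono) (auto simp: field_simps)
      also have "\<dots> \<le> (\<delta> * \<epsilon> * r) * r ^ k * r ^ (2 * k)"
      proof -
        have "1 \<le> r ^ (2 * k)" using r(3) by (rule one_le_power)
        from mult_left_mono[OF this, of "(\<delta> * \<epsilon> * r) * r ^ k"] show ?thesis
          using r(3) \<delta>(1) \<epsilon>(1) by simp
      qed
      also have "\<dots> = (\<delta> * r ^ Suc k) * (\<epsilon> * r ^ (2 * k))" by (simp add: mult_ac)
      also have "\<dots> \<le> cmod (gradient ?f (on_circle r t)) * cmod (conj_direction ?f (on_circle r t))"
        using \<delta>(1) \<epsilon>(1) r(3) by (intro mult_mono \<delta>(4)[OF r(1)] \<epsilon>(4)[OF r(2)]) auto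
      finally show ?thesis by (simp add: norm_mult)
    qed
    then show "turns (\<lambda>t. direction_field ?f (circle 0 r t)) (j + 1)"
      by (intro turns_Rouche[OF M] continuous_on_compose2[OF continuous_direction_field[of UNIV]] continuous_intros)
        (simp_all add: W)
  qed
qed

section \<open>Zeros of the top form\<close>

text \<open>
  A common zero of the two forms on the unit circle spans a line of common zeros.
\<close>

lemma no_common_zero:
  assumes g: "homogeneous (Suc (Suc k)) g" and h: "homogeneous (Suc k) h"
    and no: "\<not> (\<exists>l. linear_factor l (hess g) \<and> linear_factor l (grad_dot_perp_grad h g))"
  shows "eval2 (hess g) (pt t) \<noteq> 0 \<or> eval2 (grad_dot_perp_grad h g) (pt t) \<noteq> 0"
proof (rule ccontr)
  assume "\<not> ?thesis"
  then have z: "eval2 (hess g) (cos t, sin t) = 0" "eval2 (grad_dot_perp_grad h g) (cos t, sin t) = 0"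
    by (auto simp: pt_def)
  have nz: "cos t \<noteq> 0 \<or> sin t \<noteq> 0" using pt_nonzero[of t] by (simp add: pt_def)
  have "linear_factor (line_through (cos t) (sin t)) (hess g)"
    by (rule linear_factor_line_through[OF nz]) (simp add: eval2_hess_scale[OF g] z)
  moreover have "linear_factor (line_through (cos t) (sin t)) (grad_dot_perp_grad h g)"
    by (rule linear_factor_line_through[OF nz]) (simp add: eval2_grad_dot_perp_grad_scale[OF g h] z)
  ultimately show False using no by blast
qed

text \<open>
  A zero of the gradient is a common zero of the two forms: by Euler's identity the point itself is then
  in the kernel of the Hessian. In particular, a multiple linear factor of \<open>g\<close> is excluded.
\<close>

lemma gradient_nonzero:
  assumes g: "homogeneous (Suc (Suc k)) g"
    and nz: "eval2 (hess g) (pt t) \<noteq> 0 \<or> eval2 (grad_dot_perp_grad h g) (pt t) \<noteq> 0"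
  shows "gradient g (pt t) \<noteq> 0"
proof
  assume "gradient g (pt t) = 0"
  then have z: "eval2 (dx g) (pt t) = 0" "eval2 (dy g) (pt t) = 0"
    by (auto simp: gradient_def complex_eq_iff)
  let ?x = "fst (pt t)" and ?y = "snd (pt t)"
  let ?xx = "eval2 (dx (dx g)) (pt t)" and ?xy = "eval2 (dx (dy g)) (pt t)" and ?yy = "eval2 (dy (dy g)) (pt t)"
  have "?x * ?xx + ?y * ?xy = 0" "?x * ?xy + ?y * ?yy = 0"
    using arg_cong[OF Euler_identity[OF homogeneous_dx[OF g]], of "\<lambda>P. eval2 P (pt t)"]
      arg_cong[OF Euler_identity[OF homogeneous_dy[OF g]], of "\<lambda>P. eval2 P (pt t)"] z
    by (simp_all add: dx_dy)
  then have "?x * (?xx * ?yy - ?xy\<^sup>2) = 0" "?y * (?xx * ?yy - ?xy\<^sup>2) = 0" by algebra+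
  then have "eval2 (hess g) (pt t) = 0" using pt_nonzero[of t] by (auto simp: hess_def)
  moreover have "eval2 (grad_dot_perp_grad h g) (pt t) = 0"
    by (simp add: grad_dot_perp_grad_def z)
  ultimately show False using nz by simp
qed

text \<open>
  If the line did not pass through the origin, its multiples would sweep out all directions but one, and
  \<open>g\<close> would vanish there by homogeneity.
\<close>

lemma linear_factor_homogeneous:
  assumes g: "homogeneous d g" "g \<noteq> 0" and l: "total_degree l = 1" "l dvd g"
  obtains a b where "a \<noteq> 0 \<or> b \<noteq> 0" "l = linear_form a b"
proof -
  obtain a b c where abc: "l = [:[:a:]:] * varx + [:[:b:]:] * vary + [:[:c:]:]" "a \<noteq> 0 \<or> b \<noteq> 0"
    using total_degree_1E[OF l(1)] .
  obtain q where q: "g = l * q" using l(2) by (rule dvdE)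
  have l_eval: "eval2 l (x, y) = a * x + b * y + c" for x y
    by (simp add: abc(1) del: mult_pCons_left)
  have "c = 0"
  proof (rule ccontr)
    assume c: "c \<noteq> 0"
    have "eval2 (linear_form a b * g) p = 0" for p
    proof (cases "eval2 (linear_form a b) p = 0")
      case False
      obtain x y where p: "p = (x, y)" by (cases p)
      define s where "s = - c / (a * x + b * y)"
      have ne: "a * x + b * y \<noteq> 0" using False p by simp
      then have "s * (a * x + b * y) = - c" by (simp add: s_def)
      then have s: "a * (s * x) + b * (s * y) + c = 0" by algebra
      have "s \<noteq> 0" using c ne by (simp add: s_def)
      have "eval2 g (s * x, s * y) = 0" unfolding q using s by (simp add: l_eval)
      then have "eval2 g p = 0" using eval2_homogeneous[OF g(1), of s x y] \<open>s \<noteq> 0\<close> p by simp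
      then show ?thesis by simp
    qed simp
    then have "linear_form a b * g = 0" by (rule eval2_eq_zeroD)
    then have "linear_form a b = 0" using g(2) by simp
    then have "eval2 (linear_form a b) (a, b) = 0" by simp
    then have "a * a + b * b = 0" by simp
    then show False using abc(2) by (simp add: sum_squares_eq_zero_iff)
  qed
  then have "l = linear_form a b" by (simp add: abc(1) linear_form_def)
  then show ?thesis using that abc(2) by blast
qed

text \<open>
  One turn of the polar frame, and one negative turn for each linear factor. The remaining cofactor \<open>h\<close>
  has no zero on the circle: at such a zero the product of the linear factors would be nonzero, because the
  zeros of \<open>g\<close> are simple, and then \<open>h\<close> would inherit from \<open>g\<close> a whole line of zeros.
\<close>

lemma turns_gradient_of_form:
  assumes g: "homogeneous d g" and d: "d \<ge> 1" and nz: "\<And>t. gradient g (pt t) \<noteq> 0"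
    and L: "has_num_linear_factors g L"
  shows "turns (\<lambda>t. gradient g (pt t)) (1 - int L)"
proof -
  obtain ls h where ls: "length ls = L" "\<And>l. l \<in> set ls \<Longrightarrow> total_degree l = 1"
    and gh: "g = prod_list ls * h" and no: "\<not> (\<exists>l. linear_factor l h)"
    using L unfolding has_num_linear_factors_def by blast
  have polar: "gradient g (pt t) = cis t * polar_gradient (real d) g t" for t by (rule gradient_polar[OF g])
  have pnz: "polar_gradient (real d) g t \<noteq> 0" for t using nz[of t] polar[of t] by auto
  have "g \<noteq> 0" using pnz[of 0] by (auto simp: polar_gradient_def rot_def dx_def dy_def complex_eq_iff)
  have lin: "\<exists>a b. (a \<noteq> 0 \<or> b \<noteq> 0) \<and> l = linear_form a b" if "l \<in> set ls" for l
  proof -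
    have "l dvd prod_list ls" using that by (rule prod_list_dvd)
    then have "l dvd g" unfolding gh by simp
    from linear_factor_homogeneous[OF g \<open>g \<noteq> 0\<close> ls(2)[OF that] this] show ?thesis by metis
  qed
  have scale: "eval2 (prod_list ls) (s * x, s * y) = s ^ L * eval2 (prod_list ls) (x, y)" for s x y
    using lin ls(1)
  proof (induction ls arbitrary: L)
    case (Cons l ls)
    obtain a b where "l = linear_form a b" using Cons.prems(1)[of l] by auto
    then have "eval2 l (s * x, s * y) = s * eval2 l (x, y)" by (simp add: algebra_simps)
    moreover have "eval2 (prod_list ls) (s * x, s * y) = s ^ length ls * eval2 (prod_list ls) (x, y)"
      using Cons.IH[OF Cons.prems(1)] by simp
    ultimately show ?case using Cons.prems(2) by auto
  qed simp
  have h: "eval2 h (pt t) \<noteq> 0" for t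
  proof
    assume z: "eval2 h (pt t) = 0"
    have g0: "eval2 g (pt t) = 0" by (simp add: gh z)
    have "eval2 (prod_list ls) (pt t) \<noteq> 0"
      using pnz[of t] z by (auto simp: polar_gradient_def gh rot_mult complex_eq_iff)
    then have A: "eval2 (prod_list ls) (s * cos t, s * sin t) \<noteq> 0" if "s \<noteq> 0" for s
      using that by (simp add: scale pt_def)
    have B: "eval2 g (s * cos t, s * sin t) = 0" for s
      using eval2_homogeneous[OF g, of s "cos t" "sin t"] g0 by (simp add: pt_def)
    have "eval2 h (s * cos t, s * sin t) = 0" if "s \<noteq> 0" for s
      using A[OF that] B[of s] by (simp add: gh)
    moreover have "cos t \<noteq> 0 \<or> sin t \<noteq> 0" using pt_nonzero[of t] by (simp add: pt_def)
    ultimately show False using no linear_factor_line_through by blast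
  qed
  have "turns (polar_gradient (real d) g) (- int L)"
    using turns_polar_gradient_product[of "real d" ls h] d lin h pnz ls(1) by (simp add: gh)
  from turns_mult[OF turns_cis this] show ?thesis by (simp add: polar)
qed

theorem theorem5p2:
  fixes f :: bipoly and n L :: nat
  assumes "total_degree f = n" and "n \<ge> 2"
    and "generic f"
    and "\<forall>p \<in> umbilics f. p isolated_in umbilics f"
    and "has_num_linear_factors (hom_part n f) L"
    and "\<not> (\<exists>l. linear_factor l (hess (hom_part n f)) \<and>
               linear_factor l (grad_dot_perp_grad (hom_part (n - 1) f) (hom_part n f)))"
  shows "finite (umbilics f)
    \<and> (\<Sum>p \<in> umbilics f. line_index (max_direction f) p) = 1 - real L / 2
    \<and> (\<Sum>p \<in> umbilics f. line_index (min_direction f) p) = 1 - real L / 2"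
proof -
  obtain k where n: "n = Suc (Suc k)" using le_Suc_ex[OF assms(2)] by (auto simp: numeral_2_eq_2)
  define g h e where "g = hom_part n f" and "h = hom_part (n - 1) f" and "e = f - g - h"
  have g: "homogeneous (Suc (Suc k)) g" and h: "homogeneous (Suc k) h"
    using homogeneous_hom_part[of n f] homogeneous_hom_part[of "n - 1" f] by (simp_all add: g_def h_def n)
  have e: "degree_le (int k) e"
    using degree_le_remainder[OF assms(1)] by (simp add: e_def g_def h_def n)
  have f: "f = g + h + e" by (simp add: e_def)
  have nz: "eval2 (hess g) (pt t) \<noteq> 0 \<or> eval2 (grad_dot_perp_grad h g) (pt t) \<noteq> 0" for t
    by (rule no_common_zero[OF g h]) (use assms(6) in \<open>simp add: g_def h_def\<close>)
  have "turns (\<lambda>t. gradient g (pt t)) (1 - int L)"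
    by (rule turns_gradient_of_form[OF g]) (use gradient_nonzero[OF g nz] assms(5) in \<open>auto simp: g_def\<close>)
  from turns_direction_field_at_infinity[OF g h e nz this] obtain R where R: "R > 0"
    "\<And>r. r \<ge> R \<Longrightarrow> turns (\<lambda>t. direction_field f (circle 0 r t)) (2 - int L)"
    unfolding f[symmetric] by auto

  let ?W = "direction_field f"
  define Z where "Z = {z. ?W z = 0}"
  define \<iota> where "\<iota> z = (Re z, Im z)" for z
  have inj: "inj \<iota>" unfolding \<iota>_def inj_def by (auto simp: complex_eq_iff)
  have umb: "umbilics f = \<iota> ` Z"
  proof
    show "umbilics f \<subseteq> \<iota> ` Z"
    proof
      fix p assume "p \<in> umbilics f"
      then have "Complex (fst p) (snd p) \<in> Z" unfolding Z_def by (simp add: umbilic_iff[symmetric])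
      then show "p \<in> \<iota> ` Z" by (force simp: \<iota>_def)
    qed
    show "\<iota> ` Z \<subseteq> umbilics f" unfolding Z_def \<iota>_def by (auto simp: umbilic_iff)
  qed
  have ZR: "Z \<subseteq> ball 0 R"
  proof
    fix z assume z: "z \<in> Z"
    show "z \<in> ball 0 R"
    proof (rule ccontr)
      assume "z \<notin> ball 0 R"
      then have "turns (\<lambda>t. ?W (circle 0 (cmod z) t)) (2 - int L)" by (intro R(2)) simp
      then have "?W (circle 0 (cmod z) (Arg z)) \<noteq> 0" by (metis nonvanishing_loop_def turns_imp_loop)
      moreover have "circle 0 (cmod z) (Arg z) = z" using rcis_cmod_Arg[of z] by (simp add: circle_def rcis_def)
      ultimately show False using z by (simp add: Z_def)
    qed
  qed
  have isol: "z isolated_in Z" if "z \<in> Z" for z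
  proof -
    have "\<iota> z isolated_in umbilics f" using assms(4) that umb by blast
    then obtain T where T: "open T" "T \<inter> \<iota> ` Z = {\<iota> z}" unfolding isolated_in_def umb by blast
    have "open (\<iota> -` T)" unfolding \<iota>_def
      using T(1) by (intro open_vimage continuous_intros)
    moreover have "\<iota> -` T \<inter> Z = {z}"
    proof -
      have "w = z" if "w \<in> Z" "\<iota> w \<in> T" for w
      proof -
        have "\<iota> w \<in> {\<iota> z}" using that T(2) by blast
        then show ?thesis using injD[OF inj] by simp
      qed
      moreover have "\<iota> z \<in> T" using T(2) by blast
      ultimately show ?thesis using \<open>z \<in> Z\<close> by blast
    qed
    ultimately show ?thesis by (rule isolated_inI[OF that])
  qed
  have "closed Z" unfolding Z_def
    using continuous_closed_vimage[of "{0}" ?W] continuous_direction_field[of UNIV f]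
    by (simp add: vimage_def continuous_on_eq_continuous_at)
  moreover have "bounded Z" using ZR bounded_ball bounded_subset by blast
  ultimately have "compact Z" by (simp add: compact_eq_bounded_closed)
  moreover have "discrete Z" using isol by (auto simp: discrete_def)
  ultimately have fin: "finite Z" using discrete_compact_finite_iff by blast

  have "\<exists>k. \<forall>\<^sub>F r in at_right 0. turns (\<lambda>t. ?W (circle p r t)) k" if p: "p \<in> Z" for p
  proof -
    obtain \<epsilon> where \<epsilon>: "\<epsilon> > 0" "\<And>z. z \<in> Z \<Longrightarrow> dist p z < \<epsilon> \<Longrightarrow> z = p"
      using isolated_inE_dist[OF isol[OF p]] by metis
    obtain k where k: "\<And>r. r \<in> {0<..<\<epsilon>} \<Longrightarrow> turns (\<lambda>t. ?W (circle p r t)) k"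
    proof (rule turns_circles[of "{0<..<\<epsilon>}" "- Z" ?W p])
      show "circle p r t \<in> - Z" if "r \<in> {0<..<\<epsilon>}" for r t
      proof
        assume "circle p r t \<in> Z"
        then have "circle p r t = p" using \<epsilon>(2) that by simp
        then have "\<bar>r\<bar> = 0" using dist_circle[of p r t] by (metis dist_self)
        then show False using that by simp
      qed
    qed (use \<epsilon>(1) continuous_direction_field that in \<open>auto simp: Z_def\<close>)
    then have "\<forall>\<^sub>F r in at_right 0. turns (\<lambda>t. ?W (circle p r t)) k"
      unfolding eventually_at_right_field using \<epsilon>(1) by (intro exI[of _ \<epsilon>]) simp
    then show ?thesis by blast
  qed
  then obtain j where j: "\<And>p. p \<in> Z \<Longrightarrow> \<forall>\<^sub>F r in at_right 0. turns (\<lambda>t. ?W (circle p r t)) (j p)"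
    by metis
  have "turns (\<lambda>t. ?W (circle 0 R t)) (\<Sum>p\<in>Z. j p)"
    by (rule sum_of_local_turns[OF fin continuous_direction_field]) (use j ZR R(1) in \<open>auto simp: Z_def\<close>)
  from turns_unique[OF this R(2)] have sum: "(\<Sum>p\<in>Z. j p) = 2 - int L" by simp
  \<comment> \<open>A line that makes one half-turn corresponds to a full turn of the field.\<close>
  have half: "(\<Sum>p\<in>Z. real_of_int (j p) / 2) = 1 - real L / 2"
    unfolding sum_divide_distrib[symmetric] of_int_sum[symmetric] sum by (simp add: field_simps)
  have "(\<Sum>p \<in> umbilics f. line_index \<Lambda> p) = 1 - real L / 2"
    if "\<And>p. p \<in> Z \<Longrightarrow> line_index \<Lambda> (\<iota> p) = real_of_int (j p) / 2" for \<Lambda>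
  proof -
    have "(\<Sum>p \<in> umbilics f. line_index \<Lambda> p) = (\<Sum>p\<in>Z. line_index \<Lambda> (\<iota> p))"
      unfolding umb by (rule sum.reindex_cong[OF inj_on_subset[OF inj]]) auto
    also have "\<dots> = (\<Sum>p\<in>Z. real_of_int (j p) / 2)" by (intro sum.cong refl that)
    finally show ?thesis using half by simp
  qed
  moreover have "line_index (max_direction f) (\<iota> p) = real_of_int (j p) / 2"
    "line_index (min_direction f) (\<iota> p) = real_of_int (j p) / 2" if "p \<in> Z" for p
    unfolding \<iota>_def by (rule principal_index[OF j[OF that]])+
  ultimately show ?thesis using fin umb by simp
qed

end
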